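(* Assume that $\gamma$ is tangentially graph-like (TGL) for radius $\hat r>0$ (and thus for all $r\le\hat r$), and let $\hat s\in[0,L]$. If we know $g(s,r)$, $g_s(s,r)=\frac{\partial g(s,r)}{\partial s}$ and $g_r(s,r)=\frac{\partial g(s,r)}{\partial r}$ for all $(s,r)\in([0,L]\times\{\hat r\})\cup(\{\hat s\}\times(0,\hat r])$, then we can reconstruct $\gamma(s)\in\mathbb{R}^2$ for all $s\in[0,L]$ modulo reparametrizations, translations, and rotations.
   Context: $\Omega\subset\mathbb{R}^2$ is a compact set whose boundary $\partial\Omega$ is a simple closed, continuously differentiable curve of length $L$. $\gamma:[0,L]\to\partial\Omega$ is an arclength parameterization traversing $\partial\Omega$ counterclockwise (interior of $\Omega$ on the left), $\gamma(0)=\gamma(L)$, injective on $[0,L)$. $D(p,r)$ is the closed disk of radius $r$ centered at $p$. Integral area invariant: $g(s,r)=\mathrm{Area}(\Omega\cap D(\gamma(s),r))$. TGL: $\partial\Omega$ (continuously differentiable) is tangentially graph-like at $p\in\partial\Omega$ with radius $r$ if there is a Cartesian coordinate system with origin $p$ in which $\partial\Omega\cap D(p,r)$ is the graph of a function $f$ with $f(0)=0$ and $f'(0)=0$ (oriented so that $(0,\epsilon)\in\Omega$ for small $\epsilon>0$). $\partial\Omega$ (equivalently $\gamma$) is TGL for radius $r$ if this holds at every $p\in\partial\Omega$. "Can be reconstructed modulo reparametrizations, translations and rotations" means that the data determine the curve: any two curves that are TGL for $\hat r$, have the same length $L$, and have the same values of $g,g_s,g_r$ on the indicated set (with the same $\hat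 s$) differ by a composition of a translation and a rotation of the plane, up to reparametrization. *)

theory Defs
  imports "HOL-Analysis.Analysis"
begin

text \<open>
  The plane is the type \<^typ>\<open>complex\<close>, so that multiplication by \<^term>\<open>\<i>\<close> is the
  counterclockwise quarter turn and multiplication by \<^term>\<open>cis \<theta>\<close> is a rotation.
\<close>

text \<open>
  In the following definition \<open>\<gamma>' 0 = \<gamma>' L\<close> makes the closed curve continuously
  differentiable at the base point too, and the last conjunct says that the interior
  of \<open>\<Omega>\<close> lies on the left of the curve, i.e. that it runs counterclockwise.
\<close>

definition arclength_boundary :: "complex set \<Rightarrow> real \<Rightarrow> (real \<Rightarrow> complex) \<Rightarrow> bool" where
  "arclength_boundary \<Omega> L \<gamma> \<longleftrightarrow>
     compact \<Omega> \<and> 0 < L \<and> frontier \<Omega> = \<gamma> ` {0..L} \<and>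
     \<gamma> 0 = \<gamma> L \<and> inj_on \<gamma> {0..<L} \<and>
     (\<exists>\<gamma>'. (\<forall>s\<in>{0..L}. (\<gamma> has_vector_derivative \<gamma>' s) (at s within {0..L})) \<and>
           continuous_on {0..L} \<gamma>' \<and> \<gamma>' 0 = \<gamma>' L \<and>
           (\<forall>s\<in>{0..L}. norm (\<gamma>' s) = 1) \<and>
           (\<forall>s\<in>{0..L}. \<forall>\<^sub>F \<epsilon> in at_right 0. \<gamma> s + \<epsilon> *\<^sub>R (\<i> * \<gamma>' s) \<in> interior \<Omega>))"

text \<open>
  The orthonormal vectors \<open>u\<close>, \<open>v\<close> are the axes of the coordinate system with origin \<open>p\<close>.
  The domain \<open>A\<close> of \<open>f\<close> is only required to be a neighbourhood of \<open>0\<close>, so that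
  \<open>f'(0)\<close> makes sense; the values of \<open>f\<close> outside \<open>A\<close> are irrelevant.
\<close>

definition TGL_at :: "complex set \<Rightarrow> real \<Rightarrow> complex \<Rightarrow> bool" where
  "TGL_at \<Omega> r p \<longleftrightarrow>
     (\<exists>u v A f. norm u = 1 \<and> norm v = 1 \<and> u \<bullet> v = 0 \<and>
        0 \<in> interior A \<and> f 0 = 0 \<and> (f has_real_derivative 0) (at 0) \<and>
        frontier \<Omega> \<inter> cball p r = (\<lambda>x. p + x *\<^sub>R u + f x *\<^sub>R v) ` A \<and>
        (\<forall>\<^sub>F \<epsilon> in at_right 0. p + \<epsilon> *\<^sub>R v \<in> \<Omega>))"

definition TGL :: "complex set \<Rightarrow> real \<Rightarrow> bool" where
  "TGL \<Omega> r \<longleftrightarrow> (\<forall>p\<in>frontier \<Omega>. TGL_at \<Omega> r p)"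

definition area_inv :: "complex set \<Rightarrow> (real \<Rightarrow> complex) \<Rightarrow> real \<Rightarrow> real \<Rightarrow> real" where
  "area_inv \<Omega> \<gamma> s r = measure lebesgue (\<Omega> \<inter> cball (\<gamma> s) r)"

text \<open>
  The partial derivatives exist at all points where they are used below, as a
  consequence of the tangentially graph-like condition. The derivative in \<open>s\<close> is taken
  within \<open>[0, L]\<close> because \<open>\<gamma>\<close> is unconstrained outside this interval.
\<close>

definition area_inv_s ::
    "complex set \<Rightarrow> real \<Rightarrow> (real \<Rightarrow> complex) \<Rightarrow> real \<Rightarrow> real \<Rightarrow> real" where
  "area_inv_s \<Omega> L \<gamma> s r = vector_derivative (\<lambda>t. area_inv \<Omega> \<gamma> t r) (at s within {0..L})"

definition area_inv_r :: "complex set \<Rightarrow> (real \<Rightarrow> complex) \<Rightarrow> real \<Rightarrow> real \<Rightarrow> real" where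
  "area_inv_r \<Omega> \<gamma> s r = deriv (\<lambda>\<rho>. area_inv \<Omega> \<gamma> s \<rho>) r"

definition reparametrization :: "real \<Rightarrow> (real \<Rightarrow> real) \<Rightarrow> bool" where
  "reparametrization L \<phi> \<longleftrightarrow>
     continuous_on {0..L} \<phi> \<and> strict_mono_on {0..L} \<phi> \<and> \<phi> ` {0..L} = {0..L}"

end

theory Submission imports Defs begin

text \<open>
  The data at a boundary point see the boundary only through the circle around it. By the
  tangentially graph-like condition, the distance from a boundary point has no other critical point
  on the boundary within the disk (\<open>TGL_no_critical\<close>). Hence within the disk the boundary is
  one arc, along which the distance grows strictly on both sides, and every circle of radius
  \<open>r \<le> rhat\<close> meets the boundary in two points: one ahead, where the curve leaves the disk, and one
  behind (\<open>circle_meets_curve\<close>). The part of the circle in the region is the arc between them on the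
  left of the curve (\<open>circle_arc_region\<close>).

  The derivative of the area in \<open>r\<close> is the length of this arc, and the derivative in \<open>s\<close> is
  the difference of the heights of its two ends over the tangent line. Together
  they determine both ends in the frame of the tangent (\<open>arc_data_determine_right_end\<close>). So the
  data amount to knowing, in the frame of the curve, the chord to the first exit point: for all
  \<open>s\<close> at radius \<open>rhat\<close>, and for all radii at \<open>shat\<close> (\<open>area_data_determine_exit_chord\<close>).

  Two curves with the same chords are moved so that they have the same point and tangent at \<open>shat\<close>.
  The exit points for the radii up to \<open>rhat\<close> then trace the same arc, and a trace determines its
  parametrization by arc length (\<open>unit_speed_reparametrization_rigid\<close>), so the curves agree from
  \<open>shat\<close> until they leave the disk. Where they agree their frames agree, so
  their exit points for radius \<open>rhat\<close> agree; these run ahead of the part already known by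
  a length of at least \<open>rhat\<close>. Repeating this covers a whole period
  (\<open>exit_chords_determine_curve\<close>). The curves agree with equal parameters, so the identity is the
  required reparametrization.

  The derivatives of the area are computed from slices: horizontal ones for the
  motion of the disk (\<open>area_derivative_translation\<close>), and lines through the centre, parametrized by
  their slope, for its growth (\<open>area_derivative_radius\<close>). In both cases the slice of the disk is an
  interval whose ends move, and dominated convergence allows differentiation slice by slice.
\<close>

section \<open>Area in the plane by slices\<close>

lemma lborel_complex_prod:
  "(lborel :: complex measure) = distr (lborel \<Otimes>\<^sub>M lborel) borel (\<lambda>p. Complex (fst p) (snd p))"
proof (rule lborel_eqI)
  have meas[measurable]: "(\<lambda>p. Complex (fst p) (snd p)) \<in> borel_measurable (borel :: (real \<times> real) measure)"
    by (intro borel_measurable_continuous_onI continuous_intros)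
  fix l u :: complex assume le: "\<And>b. b \<in> Basis \<Longrightarrow> l \<bullet> b \<le> u \<bullet> b"
  have "(\<lambda>p. Complex (fst p) (snd p)) -` box l u \<inter> space lborel = box (Re l, Im l) (Re u, Im u)"
    by (auto simp: box_def Basis_complex_def Basis_prod_def ball_Un)
  then have "emeasure (distr lborel borel (\<lambda>p. Complex (fst p) (snd p))) (box l u) =
      emeasure lborel (box (Re l, Im l) (Re u, Im u))"
    by (subst emeasure_distr) auto
  also have "\<dots> = (\<Prod>b\<in>Basis. (u - l) \<bullet> b)"
  proof -
    have "Re l \<le> Re u" "Im l \<le> Im u" using le[of 1] le[of \<i>] by (auto simp: Basis_complex_def)
    then show ?thesis
      by (subst emeasure_lborel_box) (auto simp: Basis_complex_def Basis_prod_def  prod.union_disjoint ennreal_mult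
          disjoint_iff prod.reindex inj_on_def mult.commute)
  qed
  finally show "emeasure (distr (lborel \<Otimes>\<^sub>M lborel) borel (\<lambda>p. Complex (fst p) (snd p))) (box l u) =
      (\<Prod>b\<in>Basis. (u - l) \<bullet> b)" by (simp add: lborel_prod)
qed simp

lemma measurable_Complex[measurable (raw)]:
  assumes "f \<in> borel_measurable M" "g \<in> borel_measurable M"
  shows "(\<lambda>x. Complex (f x) (g x)) \<in> borel_measurable M"
  unfolding complex_of_real_def[symmetric] Complex_eq using assms by measurable

lemma nn_integral_complex:
  fixes f :: "complex \<Rightarrow> ennreal"
  assumes [measurable]: "f \<in> borel_measurable borel"
  shows "(\<integral>\<^sup>+z. f z \<partial>lborel) = (\<integral>\<^sup>+x. \<integral>\<^sup>+y. f (Complex x y) \<partial>lborel \<partial>lborel)"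
    and "(\<integral>\<^sup>+z. f z \<partial>lborel) = (\<integral>\<^sup>+y. \<integral>\<^sup>+x. f (Complex x y) \<partial>lborel \<partial>lborel)"
proof -
  show 1: "(\<integral>\<^sup>+z. f z \<partial>lborel) = (\<integral>\<^sup>+x. \<integral>\<^sup>+y. f (Complex x y) \<partial>lborel \<partial>lborel)"
    by (subst lborel_complex_prod, subst nn_integral_distr)
      (auto simp: lborel.nn_integral_fst[symmetric])
  show "(\<integral>\<^sup>+z. f z \<partial>lborel) = (\<integral>\<^sup>+y. \<integral>\<^sup>+x. f (Complex x y) \<partial>lborel \<partial>lborel)"
    unfolding 1 by (rule lborel_pair.Fubini'[symmetric]) measurable
qed

lemma integral_complex:
  fixes f :: "complex \<Rightarrow> real"
  assumes "integrable lborel f"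
  shows "(\<integral>z. f z \<partial>lborel) = (\<integral>y. \<integral>x. f (Complex x y) \<partial>lborel \<partial>lborel)"
    and "integrable lborel (\<lambda>y. \<integral>x. f (Complex x y) \<partial>lborel)"
proof -
  have [measurable]: "f \<in> borel_measurable borel" using assms by auto
  have i: "integrable (lborel \<Otimes>\<^sub>M lborel) (\<lambda>p. f (Complex (fst p) (snd p)))"
    using assms by (subst (asm) lborel_complex_prod, subst (asm) integrable_distr_eq) auto
  then have i': "integrable (lborel \<Otimes>\<^sub>M lborel) (\<lambda>(x,y). f (Complex x y))"
    by (simp add: case_prod_unfold)
  show "(\<integral>z. f z \<partial>lborel) = (\<integral>y. \<integral>x. f (Complex x y) \<partial>lborel \<partial>lborel)"
    by (subst lborel_complex_prod, subst integral_distr)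
      (use lborel_pair.integral_snd[OF i'] in \<open>auto simp: case_prod_unfold\<close>)
  show "integrable lborel (\<lambda>y. \<integral>x. f (Complex x y) \<partial>lborel)"
    using lborel_pair.integrable_snd[OF i'] by simp
qed

text \<open>
  The coordinates \<open>(x, m)\<close> with \<open>m = y / x\<close> do the work of polar coordinates: for fixed \<open>x\<close>
  the substitution \<open>y = m x\<close> is linear and contributes the factor \<open>\<bar>x\<bar>\<close>, and a disk around the
  origin meets the line of slope \<open>m\<close> in a symmetric interval.
\<close>

lemma integral_complex_slope:
  fixes f :: "complex \<Rightarrow> real"
  assumes int: "integrable lborel f" and nn: "\<And>z. 0 \<le> f z"
  shows "(\<integral>z. f z \<partial>lborel) = (\<integral>m. \<integral>x. \<bar>x\<bar> * f (Complex x (m * x)) \<partial>lborel \<partial>lborel)"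
    and "integrable lborel (\<lambda>m. \<integral>x. \<bar>x\<bar> * f (Complex x (m * x)) \<partial>lborel)"
proof -
  have [measurable]: "f \<in> borel_measurable borel" using int by auto
  let ?F = "\<lambda>(x,m). \<bar>x\<bar> * f (Complex x (m * x))"
  have m[measurable]: "?F \<in> borel_measurable (lborel \<Otimes>\<^sub>M lborel)" by measurable
  have slice: "(\<integral>\<^sup>+y. ennreal (f (Complex x y)) \<partial>lborel) = (\<integral>\<^sup>+m. ennreal (?F (x, m)) \<partial>lborel)" if "x \<noteq> 0" for x
    using that nn by (subst nn_integral_real_affine[of _ x 0])
       (auto simp: nn_integral_cmult[symmetric] ennreal_mult mult.commute)
  have "(\<integral>\<^sup>+z. ennreal (f z) \<partial>lborel) = (\<integral>\<^sup>+x. \<integral>\<^sup>+y. ennreal (f (Complex x y)) \<partial>lborel \<partial>lborel)"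
    by (rule nn_integral_complex) measurable
  also have "\<dots> = (\<integral>\<^sup>+x. \<integral>\<^sup>+m. ennreal (?F (x, m)) \<partial>lborel \<partial>lborel)"
    by (rule nn_integral_cong_AE) (use AE_lborel_singleton[of 0] slice in auto)
  also have "\<dots> = (\<integral>\<^sup>+p. ennreal (?F p) \<partial>(lborel \<Otimes>\<^sub>M lborel))"
    by (rule lborel.nn_integral_fst) measurable
  finally have eq: "(\<integral>\<^sup>+z. ennreal (f z) \<partial>lborel) = (\<integral>\<^sup>+p. ennreal (?F p) \<partial>(lborel \<Otimes>\<^sub>M lborel))" .
  have i: "integrable (lborel \<Otimes>\<^sub>M lborel) ?F"
    using int nn eq by (auto simp: integrable_iff_bounded case_prod_unfold)
  have "(\<integral>z. f z \<partial>lborel) = (\<integral>p. ?F p \<partial>(lborel \<Otimes>\<^sub>M lborel))"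
    using nn eq by (subst (1 2) integral_eq_nn_integral) (auto simp: case_prod_unfold)
  also have "\<dots> = (\<integral>m. \<integral>x. \<bar>x\<bar> * f (Complex x (m * x)) \<partial>lborel \<partial>lborel)"
    using lborel_pair.integral_snd[OF i] by simp
  finally show "(\<integral>z. f z \<partial>lborel) = (\<integral>m. \<integral>x. \<bar>x\<bar> * f (Complex x (m * x)) \<partial>lborel \<partial>lborel)" .
  show "integrable lborel (\<lambda>m. \<integral>x. \<bar>x\<bar> * f (Complex x (m * x)) \<partial>lborel)"
    using lborel_pair.integrable_snd[OF i] by simp
qed

text \<open>
  If the real part of \<open>T\<close> is nonzero, the rotation is undone by one affine substitution in each
  coordinate in turn; if it vanishes, the rotation exchanges the coordinates up to sign.
\<close>

lemma nn_integral_complex_rotate: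
  fixes f :: "complex \<Rightarrow> ennreal"
  assumes [measurable]: "f \<in> borel_measurable borel" and "norm T = 1"
  shows "(\<integral>\<^sup>+z. f (T * z) \<partial>lborel) = (\<integral>\<^sup>+z. f z \<partial>lborel)"
proof -
  define c s where "c = Re T" and "s = Im T"
  have cs: "c\<^sup>2 + s\<^sup>2 = 1" using assms(2) by (simp add: c_def s_def norm_complex_def)
  have T: "T * Complex x y = Complex (c * x - s * y) (s * x + c * y)" for x y
    by (simp add: complex_eq_iff c_def s_def)
  have L: "(\<integral>\<^sup>+z. f (T * z) \<partial>lborel) = (\<integral>\<^sup>+y. \<integral>\<^sup>+x. f (Complex (c * x - s * y) (s * x + c * y)) \<partial>lborel \<partial>lborel)"
    by (subst nn_integral_complex(2)) (auto simp: T)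
  show ?thesis
  proof (cases "c = 0")
    case False
    have "(\<integral>\<^sup>+x. f (Complex (c * x - s * y) (s * x + c * y)) \<partial>lborel)
        = (\<integral>\<^sup>+u. ennreal (1/\<bar>c\<bar>) * f (Complex u (s/c * u + y/c)) \<partial>lborel)" for y
    proof -
      have "Complex (c * (s * y / c + 1/c * u) - s * y) (s * (s * y / c + 1/c * u) + c * y) = Complex u (s/c * u + y/c)" for u
      proof -
        have "s * (s * y / c + 1/c * u) + c * y = (s * u + (s\<^sup>2 + c\<^sup>2) * y) / c"
          using False by (simp add: field_simps power2_eq_square)
        then show ?thesis using cs False by (simp add: add.commute add_divide_distrib distrib_left)
      qed
      note eq = this
      show ?thesis
        using False by (subst nn_integral_real_affine[of _ "1/c" "s * y / c"])
           (simp_all only: eq, auto simp: nn_integral_cmult)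
    qed
    then have "(\<integral>\<^sup>+z. f (T * z) \<partial>lborel) = (\<integral>\<^sup>+y. \<integral>\<^sup>+u. ennreal (1/\<bar>c\<bar>) * f (Complex u (s/c * u + y/c)) \<partial>lborel \<partial>lborel)"
      by (simp add: L)
    also have "\<dots> = (\<integral>\<^sup>+u. \<integral>\<^sup>+y. ennreal (1/\<bar>c\<bar>) * f (Complex u (s/c * u + y/c)) \<partial>lborel \<partial>lborel)"
      by (rule lborel_pair.Fubini') measurable
    also have "\<dots> = (\<integral>\<^sup>+u. \<integral>\<^sup>+v. f (Complex u v) \<partial>lborel \<partial>lborel)"
    proof (rule nn_integral_cong)
      fix u
      show "(\<integral>\<^sup>+y. ennreal (1/\<bar>c\<bar>) * f (Complex u (s/c * u + y/c)) \<partial>lborel) = (\<integral>\<^sup>+v. f (Complex u v) \<partial>lborel)"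
        using False by (subst (2) nn_integral_real_affine[of _ "1/c" "s/c * u"]) (auto simp: nn_integral_cmult)
    qed
    also have "\<dots> = (\<integral>\<^sup>+z. f z \<partial>lborel)" by (rule nn_integral_complex(1)[symmetric]) measurable
    finally show ?thesis .
  next
    case True
    then have s: "\<bar>s\<bar> = 1" using cs by (simp add: power2_eq_1_iff) auto
    have "(\<integral>\<^sup>+z. f (T * z) \<partial>lborel) = (\<integral>\<^sup>+y. \<integral>\<^sup>+x. f (Complex (- s * y) (s * x)) \<partial>lborel \<partial>lborel)"
      using L True by simp
    also have "\<dots> = (\<integral>\<^sup>+y. \<integral>\<^sup>+v. f (Complex (- s * y) v) \<partial>lborel \<partial>lborel)"
    proof (rule nn_integral_cong)
      fix y show "(\<integral>\<^sup>+x. f (Complex (- s * y) (s * x)) \<partial>lborel) = (\<integral>\<^sup>+v. f (Complex (- s * y) v) \<partial>lborel)"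
        using s by (subst (2) nn_integral_real_affine[of _ s 0]) auto
    qed
    also have "\<dots> = (\<integral>\<^sup>+u. \<integral>\<^sup>+v. f (Complex u v) \<partial>lborel \<partial>lborel)"
      using s by (subst (3) nn_integral_real_affine[of _ "-s" 0]) auto
    also have "\<dots> = (\<integral>\<^sup>+z. f z \<partial>lborel)" by (rule nn_integral_complex(1)[symmetric]) measurable
    finally show ?thesis .
  qed
qed

lemma measure_rigid_image:
  fixes S :: "complex set"
  assumes [measurable]: "S \<in> sets borel" and T: "norm T = 1"
  shows "measure lborel {z. p + T * z \<in> S} = measure lborel S"
proof -
  have "(\<integral>\<^sup>+z. indicator S (p + T * z) \<partial>lborel) = (\<integral>\<^sup>+z. indicator S (p + z) \<partial>lborel)"
    by (rule nn_integral_complex_rotate[OF _ T, of "\<lambda>z. indicator S (p + z)"]) measurable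
  also have "\<dots> = (\<integral>\<^sup>+z. indicator S z \<partial>distr lborel borel ((+) p))"
    by (subst nn_integral_distr) auto
  also have "\<dots> = emeasure lborel S"
    by (subst lborel_distr_plus) simp
  finally have e: "(\<integral>\<^sup>+z. indicator S (p + T * z) \<partial>lborel) = emeasure lborel S" .
  have "{z. p + T * z \<in> S} \<in> sets borel" by measurable
  then have "emeasure lborel {z. p + T * z \<in> S} = (\<integral>\<^sup>+z. indicator {z. p + T * z \<in> S} z \<partial>lborel)" by simp
  also have "\<dots> = (\<integral>\<^sup>+z. indicator S (p + T * z) \<partial>lborel)"
    by (rule nn_integral_cong) (simp add: indicator_def)
  finally show ?thesis using e by (simp add: measure_def)
qed

section \<open>Differentiation of slice integrals\<close>

lemma has_real_derivative_integral_dominated: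
  fixes f :: "real \<Rightarrow> 'a \<Rightarrow> real"
  assumes int: "\<And>h. integrable M (f h)" and B: "integrable M B" and D[measurable]: "D \<in> borel_measurable M"
    and "0 < e"
    and bound: "\<And>h. \<bar>h - a\<bar> < e \<Longrightarrow> AE y in M. \<bar>f h y - f a y\<bar> \<le> B y * \<bar>h - a\<bar>"
    and deriv: "AE y in M. ((\<lambda>h. f h y) has_real_derivative D y) (at a)"
  shows "((\<lambda>h. \<integral>y. f h y \<partial>M) has_real_derivative (\<integral>y. D y \<partial>M)) (at a)"
  unfolding has_field_derivative_iff tendsto_at_iff_sequentially
proof (intro allI impI)
  fix X :: "nat \<Rightarrow> real" assume X: "\<forall>i. X i \<in> UNIV - {a}" "X \<longlonglongrightarrow> a"
  have [measurable]: "f h \<in> borel_measurable M" for h using int by auto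
  obtain N where N: "\<And>n. N \<le> n \<Longrightarrow> \<bar>X n - a\<bar> < e"
    using X(2) \<open>0 < e\<close> unfolding LIMSEQ_def dist_real_def by blast
  define Y where "Y n = X (n + N)" for n
  have Y: "Y n \<noteq> a" "\<bar>Y n - a\<bar> < e" for n using X N by (auto simp: Y_def)
  have Ya: "Y \<longlonglongrightarrow> a" unfolding Y_def using X(2) by (rule LIMSEQ_ignore_initial_segment)
  have "(\<lambda>n. \<integral>y. (f (Y n) y - f a y) / (Y n - a) \<partial>M) \<longlonglongrightarrow> (\<integral>y. D y \<partial>M)"
  proof (rule integral_dominated_convergence[where w=B])
    show "AE y in M. (\<lambda>n. (f (Y n) y - f a y) / (Y n - a)) \<longlonglongrightarrow> D y"
      using deriv
    proof eventually_elim
      case (elim y)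
      then have "((\<lambda>h. (f h y - f a y) / (h - a)) \<longlongrightarrow> D y) (at a)"
        by (simp add: has_field_derivative_iff)
      moreover have "filterlim Y (at a) sequentially"
        using Ya Y(1) by (simp add: filterlim_at)
      ultimately show ?case by (rule filterlim_compose)
    qed
    show "AE y in M. norm ((f (Y n) y - f a y) / (Y n - a)) \<le> B y" for n
      using bound[OF Y(2)[of n]] 
    proof eventually_elim
      case (elim y)
      then show ?case using Y(1)[of n] by (auto simp: field_simps abs_divide)
    qed
  qed (use B in auto)
  moreover have "(\<integral>y. (f (Y n) y - f a y) / (Y n - a) \<partial>M) = ((\<integral>y. f (Y n) y \<partial>M) - (\<integral>y. f a y \<partial>M)) / (Y n - a)" for n
    unfolding integral_divide_zero using int by (subst Bochner_Integration.integral_diff) auto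
  ultimately have "(\<lambda>n. ((\<integral>y. f (Y n) y \<partial>M) - (\<integral>y. f a y \<partial>M)) / (Y n - a)) \<longlonglongrightarrow> (\<integral>y. D y \<partial>M)"
    by (simp only:)
  then have "(\<lambda>n. ((\<lambda>h. ((\<integral>y. f h y \<partial>M) - (\<integral>y. f a y \<partial>M)) / (h - a)) \<circ> X) (n + N)) \<longlonglongrightarrow> (\<integral>y. D y \<partial>M)"
    by (simp only: Y_def o_def)
  then show "((\<lambda>h. ((\<integral>y. f h y \<partial>M) - (\<integral>y. f a y \<partial>M)) / (h - a)) \<circ> X) \<longlonglongrightarrow> (\<integral>y. D y \<partial>M)"
    by (rule LIMSEQ_offset)
qed

text \<open>
  Continuity of the integrand is asked for at the two end points only, because the integrands of
  interest are indicators of plane sets along a line.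
\<close>

lemma has_real_derivative_moving_window:
  fixes f p q :: "real \<Rightarrow> real"
  assumes f: "\<And>a b. f integrable_on {a..b}" and pq: "p h < q h"
    and p: "(p has_real_derivative p') (at h)" and q: "(q has_real_derivative q') (at h)"
    and cont: "isCont f (p h)" "isCont f (q h)"
  shows "((\<lambda>x. integral {p x..q x} f) has_real_derivative (f (q h) * q' - f (p h) * p')) (at h)"
proof -
  define a b where "a = p h - 1" and "b = q h + 1"
  have G: "((\<lambda>v. integral {a..v} f) has_real_derivative f v) (at v)" if v: "v \<in> {a<..<b}" and c: "isCont f v" for v
  proof -
    have "((\<lambda>v. integral {a..v} f) has_vector_derivative f v) (at v within {a..b} - {})"
      using v c by (intro integral_has_vector_derivative_continuous_at f) (auto intro: continuous_at_imp_continuous_at_within)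
    then have "((\<lambda>v. integral {a..v} f) has_vector_derivative f v) (at v within {a<..<b})"
      by (rule has_vector_derivative_within_subset) auto
    then show ?thesis
      using v by (simp add: has_real_derivative_iff_has_vector_derivative at_within_open[of v "{a<..<b}"])
  qed
  have "((\<lambda>x. integral {a..q x} f - integral {a..p x} f) has_real_derivative (f (q h) * q' - f (p h) * p')) (at h)"
    using pq cont
    by (intro DERIV_diff DERIV_chain2[OF G p] DERIV_chain2[OF G q]) (auto simp: a_def b_def)
  moreover have "\<forall>\<^sub>F x in nhds h. integral {a..q x} f - integral {a..p x} f = integral {p x..q x} f"
  proof -
    have lim: "(p \<longlongrightarrow> p h) (nhds h)" "(q \<longlongrightarrow> q h) (nhds h)"
      using DERIV_isCont[OF p] DERIV_isCont[OF q] 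
      by (auto simp: continuous_at tendsto_nhds_iff)
    have "\<forall>\<^sub>F x in nhds h. a < p x" using order_tendstoD(1)[OF lim(1)] by (simp add: a_def)
    moreover have "\<forall>\<^sub>F x in nhds h. p x - q x < 0"
      using order_tendstoD(2)[OF tendsto_diff[OF lim], of 0] pq by simp
    ultimately show ?thesis
    proof eventually_elim
      case (elim x)
      have "integral {a..p x} f + integral {p x..q x} f = integral {a..q x} f"
        using elim by (intro Henstock_Kurzweil_Integration.integral_combine f) auto
      then show ?case by simp
    qed
  qed
  ultimately show ?thesis
    by (simp cong: DERIV_cong_ev)
qed

text \<open>
  This is the domination needed to differentiate under the outer integral: changing the window
  changes the integral by at most what the antiderivative \<open>W\<close> of a majorant changes at the ends.
\<close>

lemma window_integral_variation:
  fixes f w W :: "real \<Rightarrow> real"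
  assumes f: "\<And>a b. f integrable_on {a..b}" and nn: "\<And>x. 0 \<le> f x" "\<And>x. f x \<le> w x"
    and W: "\<And>x. (W has_real_derivative w x) (at x)"
    and pq: "p \<le> q" "p0 \<le> q0"
  shows "\<bar>integral {p..q} f - integral {p0..q0} f\<bar> \<le> \<bar>W q - W q0\<bar> + \<bar>W p - W p0\<bar>"
proof -
  define a where "a = min p p0"
  let ?G = "\<lambda>v. integral {a..v} f"
  have main: "\<bar>?G v - ?G u\<bar> \<le> \<bar>W v - W u\<bar>" if "a \<le> u" "u \<le> v" for u v
  proof -
    have w: "(w has_integral (W v - W u)) {u..v}"
      using that W by (intro fundamental_theorem_of_calculus)
        (auto simp: has_real_derivative_iff_has_vector_derivative[symmetric] intro: has_field_derivative_at_within)
    have "?G u + integral {u..v} f = ?G v"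
      using that by (intro Henstock_Kurzweil_Integration.integral_combine f) auto
    moreover have "0 \<le> integral {u..v} f" using nn f by (intro integral_nonneg) auto
    moreover have "integral {u..v} f \<le> W v - W u"
      using integral_le[OF f has_integral_integrable[OF w]] nn integral_unique[OF w] by auto
    ultimately show ?thesis by auto
  qed
  have main': "\<bar>?G v - ?G u\<bar> \<le> \<bar>W v - W u\<bar>" if "a \<le> u" "a \<le> v" for u v
    using main[of u v] main[of v u] that by (cases "u \<le> v") (auto simp: abs_minus_commute)
  have "?G p + integral {p..q} f = ?G q" "?G p0 + integral {p0..q0} f = ?G q0"
    using pq by (intro Henstock_Kurzweil_Integration.integral_combine f; auto simp: a_def)+
  moreover have "\<bar>?G q - ?G q0\<bar> \<le> \<bar>W q - W q0\<bar>" "\<bar>?G p - ?G p0\<bar> \<le> \<bar>W p - W p0\<bar>"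
    using pq by (intro main'; auto simp: a_def)+
  ultimately show ?thesis by linarith
qed

lemma window_integrable:
  fixes g w :: "real \<Rightarrow> real"
  assumes [measurable]: "g \<in> borel_measurable borel" and nn: "\<And>x. 0 \<le> g x" "\<And>x. g x \<le> w x"
    and w: "continuous_on UNIV w"
  shows "g integrable_on {a..b}" "(\<integral>x. indicator {a..b} x * g x \<partial>lborel) = integral {a..b} g"
proof -
  have "set_integrable lborel {a..b} w"
    by (rule borel_integrable_atLeastAtMost') (use w continuous_on_subset in blast)
  then have i: "set_integrable lborel {a..b} g"
    by (rule set_integrable_bound) (use nn in \<open>auto simp: set_borel_measurable_def intro!: AE_I2 order_trans[OF nn(2)]\<close>)
  show "g integrable_on {a..b}" "(\<integral>x. indicator {a..b} x * g x \<partial>lborel) = integral {a..b} g"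
    using set_borel_integral_eq_integral[OF i] by (auto simp: set_lebesgue_integral_def)
qed

lemma integrable_indicator_cball:
  fixes E :: "complex set"
  assumes "E \<in> sets borel"
  shows "integrable lborel (indicator (E \<inter> cball c r) :: complex \<Rightarrow> real)"
proof -
  have "bounded (E \<inter> cball c r)" by (rule bounded_subset[OF bounded_cball]) auto
  then show ?thesis
    using assms emeasure_bounded_finite by (intro integrable_real_indicator) (auto simp: less_top[symmetric])
qed

lemma isCont_indicator_slice:
  fixes g :: "real \<Rightarrow> complex"
  assumes "g x \<notin> frontier E" "isCont g x"
  shows "isCont (\<lambda>x. indicator E (g x) :: real) x"
  using continuous_at_compose[OF assms(2), of "indicator E"] assms(1) isCont_indicator[of "g x" E]
  by (simp add: o_def)

text \<open>
  Almost every slice meets the circle away from the frontier of the set; \<open>g y\<close> is the point where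
  the slice \<open>y\<close> leaves the disk.
\<close>

lemma finite_slice_avoids:
  fixes F :: "complex set" and g :: "real \<Rightarrow> complex"
  assumes "finite F" "\<And>y y'. g y = g y' \<Longrightarrow> y = y'"
  shows "AE y in lborel. g y \<notin> F"
proof -
  have "finite (g -` F)" using assms by (intro finite_vimageI) (auto simp: inj_def)
  then have "AE y in lborel. y \<notin> g -` F" by (intro AE_not_in finite_imp_null_set_lborel)
  then show ?thesis by simp
qed

section \<open>The area of a set in a moving or growing disk\<close>

text \<open>
  The weight \<open>1 / (1 + m\<^sup>2)\<close> is the angle element \<open>d\<theta>\<close> written in the slope \<open>m = tan \<theta>\<close>.
\<close>

lemma integral_arctan_upper_tail:
  fixes a :: real
  shows "integrable lborel (\<lambda>m. indicator {a<..} m * (1 / (1 + m\<^sup>2)))"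
    and "(\<integral>m. indicator {a<..} m * (1 / (1 + m\<^sup>2)) \<partial>lborel) = pi / 2 - arctan a"
proof -
  have "(\<integral>\<^sup>+m. ennreal (1 / (1 + m\<^sup>2)) * indicator {a..} m \<partial>lborel) = ennreal (pi / 2 - arctan a)"
  proof (rule nn_integral_FTC_atLeast)
    show "((arctan has_real_derivative 1 / (1 + x\<^sup>2)) (at x))" for x
      using DERIV_arctan[of x] by (simp add: divide_inverse)
  qed (auto intro: tendsto_arctan_at_top)
  moreover have "(\<integral>\<^sup>+m. ennreal (1 / (1 + m\<^sup>2)) * indicator {a..} m \<partial>lborel)
      = (\<integral>\<^sup>+m. ennreal (indicator {a<..} m * (1 / (1 + m\<^sup>2))) \<partial>lborel)"
    by (rule nn_integral_cong_AE, use AE_lborel_singleton[of a] in eventually_elim)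
      (auto simp: indicator_def)
  ultimately have nn: "(\<integral>\<^sup>+m. ennreal (indicator {a<..} m * (1 / (1 + m\<^sup>2))) \<partial>lborel) = ennreal (pi / 2 - arctan a)"
    by (simp only:)
  have ar: "0 \<le> pi / 2 - arctan a" using arctan_ubound[of a] by simp
  have "has_bochner_integral lborel (\<lambda>m. indicator {a<..} m * (1 / (1 + m\<^sup>2))) (pi / 2 - arctan a)"
  proof (rule has_bochner_integral_nn_integral[OF _ _ ar nn])
    show "(\<lambda>m. indicator {a<..} m * (1 / (1 + m\<^sup>2))) \<in> borel_measurable lborel" by measurable
  qed (simp add: indicator_def)
  then show "integrable lborel (\<lambda>m. indicator {a<..} m * (1 / (1 + m\<^sup>2)))"
    "(\<integral>m. indicator {a<..} m * (1 / (1 + m\<^sup>2)) \<partial>lborel) = pi / 2 - arctan a"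
    by (auto simp only: has_bochner_integral_iff)
qed

lemma integral_arctan_lower_tail:
  fixes b :: real
  shows "integrable lborel (\<lambda>m. indicator {..<-b} m * (1 / (1 + m\<^sup>2)))"
    and "(\<integral>m. indicator {..<-b} m * (1 / (1 + m\<^sup>2)) \<partial>lborel) = pi / 2 - arctan b"
proof -
  have e: "indicator {..<-b} (0 + - 1 * m) * (1 / (1 + (0 + - 1 * m)\<^sup>2)) = indicator {b<..} m * (1 / (1 + m\<^sup>2))" for m
    by (auto simp: indicator_def)
  show "integrable lborel (\<lambda>m. indicator {..<-b} m * (1 / (1 + m\<^sup>2)))"
    using lborel_integrable_real_affine_iff[of "-1" "\<lambda>m. indicator {..<-b} m * (1 / (1 + m\<^sup>2))" 0]
      integral_arctan_upper_tail(1)[of b] unfolding e by simp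
  show "(\<integral>m. indicator {..<-b} m * (1 / (1 + m\<^sup>2)) \<partial>lborel) = pi / 2 - arctan b"
    using lborel_integral_real_affine[of "-1" "\<lambda>m. indicator {..<-b} m * (1 / (1 + m\<^sup>2))" 0]
      integral_arctan_upper_tail(2)[of b] unfolding e by simp
qed

lemma integrable_inverse_square_plus_one: "integrable lborel (\<lambda>m::real. 1 / (1 + m\<^sup>2))"
proof -
  have "AE m in lborel. indicator {0<..} m * (1 / (1 + m\<^sup>2)) + indicator {..<-0} m * (1 / (1 + m\<^sup>2)) = (1 / (1 + m\<^sup>2) :: real)"
    by (rule eventually_mono[OF AE_lborel_singleton[of "0::real"]]) (auto simp: indicator_def)
  then show ?thesis
    using Bochner_Integration.integrable_add[OF integral_arctan_upper_tail(1)[of 0] integral_arctan_lower_tail(1)[of 0]]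
    by (subst integrable_cong_AE[symmetric]) auto
qed

text \<open>
  The slice of the moving disk at height \<open>y\<close> is the window from \<open>h - sqrt (\<rho>\<^sup>2 - y\<^sup>2)\<close> to
  \<open>h + sqrt (\<rho>\<^sup>2 - y\<^sup>2)\<close>, which gains at its right end and loses at its left end at unit speed.
  A slice whose ends are off the frontier of \<open>E\<close> therefore has the derivative one expects, and
  dominated convergence integrates these derivatives over \<open>y\<close>.
\<close>

lemma area_derivative_translation:
  fixes E :: "complex set" and \<rho> :: real
  assumes E[measurable]: "E \<in> sets borel" and \<rho>: "0 < \<rho>" and fin: "finite (frontier E \<inter> sphere 0 \<rho>)"
  shows "((\<lambda>h. measure lborel (E \<inter> cball (of_real h) \<rho>)) has_real_derivative
    (\<integral>y. indicator {-\<rho><..<\<rho>} y *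
       (indicator E (Complex (sqrt (\<rho>\<^sup>2 - y\<^sup>2)) y) - indicator E (Complex (- sqrt (\<rho>\<^sup>2 - y\<^sup>2)) y)) \<partial>lborel)) (at 0)"
proof -
  define X where "X y = sqrt (\<rho>\<^sup>2 - y\<^sup>2)" for y
  define f :: "real \<Rightarrow> real \<Rightarrow> real" where "f y x = indicator E (Complex x y)" for y x
  define I :: "real \<Rightarrow> real \<Rightarrow> real" where
    "I h y = (\<integral>x. indicator (E \<inter> cball (of_real h) \<rho>) (Complex x y) \<partial>lborel)" for h y
  have [measurable]: "f y \<in> borel_measurable borel" for y unfolding f_def by measurable
  have f01: "0 \<le> f y x" "f y x \<le> 1" for y x by (auto simp: f_def indicator_def)
  have fint: "f y integrable_on {a..b}" "(\<integral>x. indicator {a..b} x * f y x \<partial>lborel) = integral {a..b} (f y)" for y a b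
    using window_integrable[of "f y" "\<lambda>_. 1" a b] f01 by auto
  have in_ball: "Complex x y \<in> cball (of_real h) \<rho> \<longleftrightarrow> \<bar>y\<bar> \<le> \<rho> \<and> x \<in> {h - X y..h + X y}" for x y h
  proof -
    have "Complex x y \<in> cball (of_real h) \<rho> \<longleftrightarrow> norm (Complex (h - x) (- y)) \<le> \<rho>"
      by (simp add: dist_norm complex_of_real_def minus_complex.code)
    also have "\<dots> \<longleftrightarrow> (x - h)\<^sup>2 + y\<^sup>2 \<le> \<rho>\<^sup>2"
      using \<rho> by (simp add: norm_complex_def real_sqrt_le_iff' power2_commute)
    also have "\<dots> \<longleftrightarrow> \<bar>y\<bar> \<le> \<rho> \<and> (x - h)\<^sup>2 \<le> \<rho>\<^sup>2 - y\<^sup>2"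
      using abs_le_square_iff[of y \<rho>] zero_le_power2[of "x - h"] \<rho>
      by (smt (verit))
    also have "\<dots> \<longleftrightarrow> \<bar>y\<bar> \<le> \<rho> \<and> \<bar>x - h\<bar> \<le> X y"
      unfolding X_def by (metis real_sqrt_abs real_sqrt_le_iff)
    finally show ?thesis by (auto simp: abs_le_iff)
  qed
  have I: "I h y = (if \<bar>y\<bar> \<le> \<rho> then integral {h - X y..h + X y} (f y) else 0)" for h y
  proof -
    have "indicator (E \<inter> cball (of_real h) \<rho>) (Complex x y)
        = (if \<bar>y\<bar> \<le> \<rho> then indicator {h - X y..h + X y} x * f y x else 0)" for x
      using in_ball[of x y h] by (auto simp: indicator_def f_def)
    then show ?thesis using fint(2) by (simp add: I_def)
  qed
  have area: "measure lborel (E \<inter> cball (of_real h) \<rho>) = (\<integral>y. I h y \<partial>lborel)" "integrable lborel (I h)" for h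
    using integral_complex[OF integrable_indicator_cball[OF E, of "of_real h" \<rho>]]
    by (auto simp: I_def[abs_def])
  have X0: "0 \<le> X y" if "\<bar>y\<bar> \<le> \<rho>" for y
    using that \<rho> abs_le_square_iff[of y \<rho>] by (simp add: X_def)
  have Xpos: "0 < X y" "norm (Complex (X y) y) = \<rho>" "norm (Complex (- X y) y) = \<rho>" if "\<bar>y\<bar> < \<rho>" for y
  proof -
    have "y\<^sup>2 < \<rho>\<^sup>2" using power_strict_mono[of "\<bar>y\<bar>" \<rho> 2] that by simp
    then show "0 < X y" "norm (Complex (X y) y) = \<rho>" "norm (Complex (- X y) y) = \<rho>"
      using \<rho> by (auto simp: X_def norm_complex_def)
  qed
  have "((\<lambda>h. \<integral>y. I h y \<partial>lborel) has_real_derivative (\<integral>y. indicator {-\<rho><..<\<rho>} y * (f y (X y) - f y (- X y)) \<partial>lborel)) (at 0)"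
  proof (rule has_real_derivative_integral_dominated[where B="\<lambda>y. 2 * indicator {-\<rho>..\<rho>} y" and e=1])
    show "AE y in lborel. \<bar>I h y - I 0 y\<bar> \<le> 2 * indicator {- \<rho>..\<rho>} y * \<bar>h - 0\<bar>" for h
    proof (rule AE_I2)
      fix y
      have "\<bar>integral {h - X y..h + X y} (f y) - integral {0 - X y..0 + X y} (f y)\<bar>
          \<le> \<bar>(h + X y) - (0 + X y)\<bar> + \<bar>(h - X y) - (0 - X y)\<bar>" if "\<bar>y\<bar> \<le> \<rho>"
        using X0[OF that] by (intro window_integral_variation[where w="\<lambda>_. 1"] fint f01) auto
      then show "\<bar>I h y - I 0 y\<bar> \<le> 2 * indicator {- \<rho>..\<rho>} y * \<bar>h - 0\<bar>"
        by (auto simp: I indicator_def)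
    qed
    have "AE y in lborel. Complex (X y) y \<notin> frontier E \<inter> sphere 0 \<rho>"
      "AE y in lborel. Complex (- X y) y \<notin> frontier E \<inter> sphere 0 \<rho>"
      by (intro finite_slice_avoids[OF fin]; simp)+
    moreover have "AE y in lborel. y \<notin> {\<rho>, -\<rho>}"
      by (intro AE_not_in finite_imp_null_set_lborel) auto
    ultimately show "AE y in lborel. ((\<lambda>h. I h y) has_real_derivative indicator {- \<rho><..<\<rho>} y * (f y (X y) - f y (- X y))) (at 0)"
    proof eventually_elim
      case (elim y)
      show ?case
      proof (cases "\<bar>y\<bar> < \<rho>")
        case True
        have "isCont (\<lambda>x. Complex x y) x" for x unfolding Complex_eq by (intro continuous_intros)
        then have c: "isCont (f y) (X y)" "isCont (f y) (- X y)"
          unfolding f_def using elim Xpos[OF True] by (auto intro!: isCont_indicator_slice)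
        have "((\<lambda>h. integral {h - X y..h + X y} (f y)) has_real_derivative (f y (0 + X y) * 1 - f y (0 - X y) * 1)) (at 0)"
          using Xpos[OF True] c by (intro has_real_derivative_moving_window fint) (auto intro!: derivative_eq_intros)
        moreover have "y \<in> {-\<rho><..<\<rho>}" using True by auto
        ultimately show ?thesis using True by (simp add: I)
      next
        case False
        then have "\<bar>y\<bar> > \<rho>" using elim by auto
        moreover have "y \<notin> {-\<rho><..<\<rho>}" using False by auto
        ultimately show ?thesis by (simp add: I)
      qed
    qed
    show "(\<lambda>y. indicator {- \<rho><..<\<rho>} y * (f y (X y) - f y (- X y))) \<in> borel_measurable lborel"
      unfolding f_def X_def by measurable
  qed (use area \<rho> in \<open>auto intro!: integrable_real_indicator simp: emeasure_lborel_Icc\<close>)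
  then show ?thesis by (simp add: area f_def X_def)
qed

text \<open>
  On the line of slope \<open>m\<close> the disk of radius \<open>r\<close> cuts out the window of half-length
  \<open>r / sqrt (1 + m\<^sup>2)\<close>, over which \<open>\<bar>x\<bar>\<close> is integrated. Both ends move outwards, and the
  derivative of each slice is \<open>\<rho> / (1 + m\<^sup>2)\<close> times the number of ends that lie in \<open>E\<close>.
\<close>

lemma area_derivative_radius:
  fixes E :: "complex set" and \<rho> :: real
  assumes E[measurable]: "E \<in> sets borel" and \<rho>: "0 < \<rho>" and fin: "finite (frontier E \<inter> sphere 0 \<rho>)"
  defines "X \<equiv> \<lambda>m. \<rho> / sqrt (1 + m\<^sup>2)"
  shows "((\<lambda>r. measure lborel (E \<inter> cball 0 r)) has_real_derivative
    (\<integral>m. \<rho> / (1 + m\<^sup>2) *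
       (indicator E (Complex (X m) (m * X m)) + indicator E (- Complex (X m) (m * X m))) \<partial>lborel)) (at \<rho>)"
proof -
  define K :: "real \<Rightarrow> real" where "K m = sqrt (1 + m\<^sup>2)" for m
  have Kpos: "0 < K m" "K m ^ 2 = 1 + m\<^sup>2" for m by (auto simp: K_def add_pos_nonneg)
  have Knz: "1 + m\<^sup>2 \<noteq> 0" for m :: real using add_pos_nonneg[OF zero_less_one zero_le_power2[of m]] by linarith
  define f :: "real \<Rightarrow> real \<Rightarrow> real" where "f m x = \<bar>x\<bar> * indicator E (Complex x (m * x))" for m x
  define J :: "real \<Rightarrow> real \<Rightarrow> real" where
    "J r m = (\<integral>x. \<bar>x\<bar> * indicator (E \<inter> cball 0 r) (Complex x (m * x)) \<partial>lborel)" for r m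
  have [measurable]: "f m \<in> borel_measurable borel" for m unfolding f_def by measurable
  have f01: "0 \<le> f m x" "f m x \<le> \<bar>x\<bar>" for m x by (auto simp: f_def indicator_def)
  have ab: "continuous_on UNIV (\<lambda>x::real. \<bar>x\<bar>)" by (intro continuous_intros)
  have fint: "f m integrable_on {a..b}" "(\<integral>x. indicator {a..b} x * f m x \<partial>lborel) = integral {a..b} (f m)" for m a b
    using window_integrable[of "f m" abs a b] f01 ab by auto
  have in_ball: "Complex x (m * x) \<in> cball 0 r \<longleftrightarrow> x \<in> {- (r / K m)..r / K m}" for x m r
  proof -
    have "norm (Complex x (m * x)) = \<bar>x\<bar> * K m"
    proof -
      have "x\<^sup>2 + (m * x)\<^sup>2 = x\<^sup>2 * (1 + m\<^sup>2)" by (simp add: algebra_simps power_mult_distrib)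
      then show ?thesis by (simp add: norm_complex_def K_def real_sqrt_mult)
    qed
    then have "Complex x (m * x) \<in> cball 0 r \<longleftrightarrow> \<bar>x\<bar> \<le> r / K m"
      using Kpos[of m] by (simp add: pos_le_divide_eq)
    then show ?thesis by auto
  qed
  have J: "J r m = integral {- (r / K m)..r / K m} (f m)" for r m
  proof -
    have "\<bar>x\<bar> * indicator (E \<inter> cball 0 r) (Complex x (m * x))
        = indicator {- (r / K m)..r / K m} x * f m x" for x
      using in_ball[of x m r] by (auto simp: indicator_def f_def)
    then show ?thesis using fint(2) by (simp add: J_def)
  qed
  have area: "measure lborel (E \<inter> cball 0 r) = (\<integral>m. J r m \<partial>lborel)" "integrable lborel (J r)" for r
    using integral_complex_slope[OF integrable_indicator_cball[OF E, of 0 r]]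
    by (auto simp: J_def[abs_def])
  have Xeq: "X m = \<rho> / K m" for m by (simp add: X_def K_def)
  have Xpos: "0 < X m" "norm (Complex (X m) (m * X m)) = \<rho>" for m
  proof -
    show p: "0 < X m" using \<rho> Kpos by (simp add: Xeq)
    have "(X m)\<^sup>2 + (m * X m)\<^sup>2 = (X m)\<^sup>2 * (K m)\<^sup>2" by (simp add: Kpos algebra_simps power_mult_distrib)
    also have "\<dots> = \<rho>\<^sup>2" using Kpos[of m] Knz[of m] by (simp add: Xeq power_divide)
    finally show "norm (Complex (X m) (m * X m)) = \<rho>" using \<rho> by (simp add: norm_complex_def)
  qed
  define W :: "real \<Rightarrow> real" where "W x = x * \<bar>x\<bar> / 2" for x
  have W: "(W has_real_derivative \<bar>x\<bar>) (at x)" for x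
  proof -
    consider "x > 0" | "x < 0" | "x = 0" by linarith
    then show ?thesis
    proof cases
      case 1
      have "((\<lambda>x. x * x / 2) has_real_derivative \<bar>x\<bar>) (at x)"
        using 1 by (auto intro!: derivative_eq_intros)
      moreover have "\<forall>\<^sub>F y in nhds x. y * y / 2 = W y"
        using eventually_nhds_in_open[of "{0<..}" x] 1 by (auto simp: W_def elim!: eventually_mono)
      ultimately show ?thesis by (simp cong: DERIV_cong_ev)
    next
      case 2
      have "((\<lambda>x. - (x * x) / 2) has_real_derivative \<bar>x\<bar>) (at x)"
        using 2 by (auto intro!: derivative_eq_intros)
      moreover have "\<forall>\<^sub>F y in nhds x. - (y * y) / 2 = W y"
        using eventually_nhds_in_open[of "{..<0}" x] 2 by (auto simp: W_def elim!: eventually_mono)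
      ultimately show ?thesis by (simp cong: DERIV_cong_ev)
    next
      case 3
      have "((\<lambda>h. \<bar>h\<bar> / 2) \<longlongrightarrow> (0::real)) (at 0)" by (auto intro!: tendsto_eq_intros)
      then have "((\<lambda>h. W h / h) \<longlongrightarrow> 0) (at 0)"
        by (rule Lim_transform_within[where d=1]) (auto simp: W_def)
      then show ?thesis using 3 by (simp add: DERIV_def W_def)
    qed
  qed
  note Kint = integrable_inverse_square_plus_one
  have "((\<lambda>r. \<integral>m. J r m \<partial>lborel) has_real_derivative
     (\<integral>m. f m (X m) * (1 / K m) - f m (- X m) * (- (1 / K m)) \<partial>lborel)) (at \<rho>)"
  \<comment> \<open>For radii between \<open>0\<close> and \<open>2 * \<rho>\<close> one has \<open>\<bar>r\<^sup>2 - \<rho>\<^sup>2\<bar> \<le> 3 * \<rho> * \<bar>r - \<rho>\<bar>\<close>.\<close>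
  proof (rule has_real_derivative_integral_dominated[where B="\<lambda>m. 3 * \<rho> * (1 / (1 + m\<^sup>2))" and e=\<rho>])
    fix r assume r: "\<bar>r - \<rho>\<bar> < \<rho>"
    show "AE m in lborel. \<bar>J r m - J \<rho> m\<bar> \<le> 3 * \<rho> * (1 / (1 + m\<^sup>2)) * \<bar>r - \<rho>\<bar>"
    proof (rule AE_I2)
      fix m
      have "\<bar>J r m - J \<rho> m\<bar> \<le> \<bar>W (r / K m) - W (\<rho> / K m)\<bar> + \<bar>W (- (r / K m)) - W (- (\<rho> / K m))\<bar>"
        unfolding J using Kpos[of m] \<rho> r by (intro window_integral_variation[where w=abs] fint f01 W) auto
      also have "\<dots> = \<bar>(r / K m)\<^sup>2 - (\<rho> / K m)\<^sup>2\<bar>"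
      proof -
        have W2: "W u = u\<^sup>2 / 2" "W (- u) = - u\<^sup>2 / 2" if "0 < u" for u
          using that by (auto simp: W_def power2_eq_square)
        have "0 < r / K m" "0 < \<rho> / K m" using Kpos[of m] \<rho> r by auto
        from W2[OF this(1)] W2[OF this(2)] show ?thesis by (auto simp: abs_if)
      qed
      also have "\<dots> = \<bar>r + \<rho>\<bar> * \<bar>r - \<rho>\<bar> / (1 + m\<^sup>2)"
        using Kpos(2)[of m] by (simp add: power_divide diff_divide_distrib[symmetric] power2_eq_square[of r] square_diff_square_factored  power2_eq_square[of \<rho>] abs_mult abs_divide)
      also have "\<dots> \<le> 3 * \<rho> * \<bar>r - \<rho>\<bar> / (1 + m\<^sup>2)"
        using r by (intro divide_right_mono mult_right_mono) auto
      finally show "\<bar>J r m - J \<rho> m\<bar> \<le> 3 * \<rho> * (1 / (1 + m\<^sup>2)) * \<bar>r - \<rho>\<bar>" by simp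
    qed
  next
    have inj: "Complex (X y) (y * X y) = Complex (X y') (y' * X y') \<Longrightarrow> y = y'" 
       "- Complex (X y) (y * X y) = - Complex (X y') (y' * X y') \<Longrightarrow> y = y'" for y y'
      using Xpos(1)[of y] Xpos(1)[of y'] by auto
    have "AE m in lborel. Complex (X m) (m * X m) \<notin> frontier E \<inter> sphere 0 \<rho>"
      "AE m in lborel. - Complex (X m) (m * X m) \<notin> frontier E \<inter> sphere 0 \<rho>"
      by (intro finite_slice_avoids[OF fin] inj; assumption)+
    then show "AE m in lborel. ((\<lambda>r. J r m) has_real_derivative f m (X m) * (1 / K m) - f m (- X m) * (- (1 / K m))) (at \<rho>)"
    proof eventually_elim
      case (elim m)
      have neg: "Complex (- X m) (m * - X m) = - Complex (X m) (m * X m)" by (simp add: complex_eq_iff)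
      have i: "isCont (\<lambda>x. Complex x (m * x)) x" for x unfolding Complex_eq by (intro continuous_intros)
      have c: "isCont (f m) (X m)" "isCont (f m) (- X m)"
        unfolding f_def using elim Xpos[of m] neg
        by (auto intro!: continuous_mult isCont_indicator_slice i continuous_intros)
      show ?case
        unfolding J Xeq using Xpos[of m] c Kpos[of m]
        by (intro has_real_derivative_moving_window fint) (auto simp: Xeq intro!: derivative_eq_intros)
    qed
    show "(\<lambda>m. f m (X m) * (1 / K m) - f m (- X m) * - (1 / K m)) \<in> borel_measurable lborel"
      unfolding f_def X_def K_def by measurable
    show "integrable lborel (\<lambda>m. 3 * \<rho> * (1 / (1 + m\<^sup>2)))"
      by (intro integrable_mult_right Kint)
  qed (use area \<rho> in auto)
  moreover have "f m (X m) * (1 / K m) - f m (- X m) * (- (1 / K m)) = \<rho> / (1 + m\<^sup>2) *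
       (indicator E (Complex (X m) (m * X m)) + indicator E (- Complex (X m) (m * X m)))" for m
  proof -
    have neg: "Complex (- X m) (- (m * X m)) = - Complex (X m) (m * X m)" by (simp add: complex_eq_iff)
    have "f m (X m) * (1 / K m) - f m (- X m) * (- (1 / K m)) = (X m * (1 / K m)) *
       (indicator E (Complex (X m) (m * X m)) + indicator E (- Complex (X m) (m * X m)))"
      using Xpos[of m] by (simp add: f_def neg distrib_left)
    also have "X m * (1 / K m) = \<rho> / (K m)\<^sup>2" by (simp add: Xeq power2_eq_square)
    finally show ?thesis by (simp only: Kpos(2))
  qed
  ultimately show ?thesis by (simp add: area)
qed

section \<open>Sets that meet a circle in an upper arc\<close>

text \<open>
  Up to finitely many points, the part of the circle of radius \<open>\<rho>\<close> in \<open>E\<close> is the upper arc between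
  the point of the right half circle at height \<open>yR\<close> and the point of the left half circle at
  height \<open>yL\<close>.
\<close>

locale circle_arc =
  fixes E :: "complex set" and \<rho> yR yL :: real
  assumes borel: "E \<in> sets borel" and pos: "0 < \<rho>" and fin: "finite (frontier E \<inter> sphere 0 \<rho>)"
    and yR: "\<bar>yR\<bar> < \<rho>" and yL: "\<bar>yL\<bar> < \<rho>"
    and right: "\<And>z. norm z = \<rho> \<Longrightarrow> 0 < Re z \<Longrightarrow> Im z \<noteq> yR \<Longrightarrow> z \<in> E \<longleftrightarrow> yR < Im z"
    and left: "\<And>z. norm z = \<rho> \<Longrightarrow> Re z < 0 \<Longrightarrow> Im z \<noteq> yL \<Longrightarrow> z \<in> E \<longleftrightarrow> yL < Im z"
begin

text \<open>
  The right half of the arc has height \<open>\<rho> - yR\<close> and gains area, the left half has height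
  \<open>\<rho> - yL\<close> and loses area.
\<close>

lemma translation_derivative:
  "((\<lambda>h. measure lborel (E \<inter> cball (of_real h) \<rho>)) has_real_derivative (yL - yR)) (at 0)"
proof -
  note borel[measurable]
  let ?X = "\<lambda>y. sqrt (\<rho>\<^sup>2 - y\<^sup>2)"
  have n: "norm (Complex (?X y) y) = \<rho>" "norm (Complex (- ?X y) y) = \<rho>" "0 < ?X y" if "\<bar>y\<bar> < \<rho>" for y
  proof -
    have "y\<^sup>2 < \<rho>\<^sup>2" using power_strict_mono[of "\<bar>y\<bar>" \<rho> 2] that by simp
    then show "norm (Complex (?X y) y) = \<rho>" "norm (Complex (- ?X y) y) = \<rho>" "0 < ?X y"
      using pos by (auto simp: norm_complex_def)
  qed
  have "(\<integral>y. indicator {-\<rho><..<\<rho>} y *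
       (indicator E (Complex (?X y) y) - indicator E (Complex (- ?X y) y)) \<partial>lborel)
     = (\<integral>y. indicator {yR..\<rho>} y - indicator {yL..\<rho>} y \<partial>lborel :: real)"
  proof (rule integral_cong_AE)
    have "AE y in lborel. y \<notin> {\<rho>, -\<rho>, yR, yL}"
      by (intro AE_not_in finite_imp_null_set_lborel) auto
    then show "AE y in lborel. indicator {-\<rho><..<\<rho>} y *
       (indicator E (Complex (?X y) y) - indicator E (Complex (- ?X y) y)) = (indicator {yR..\<rho>} y - indicator {yL..\<rho>} y :: real)"
    proof eventually_elim
      case (elim y)
      show ?case
      proof (cases "\<bar>y\<bar> < \<rho>")
        case True
        then show ?thesis using right[OF n(1)[OF True]] left[OF n(2)[OF True]] n(3)[OF True] elim
          by (auto simp: indicator_def)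
      next
        case False
        then show ?thesis using yR yL elim by (auto simp: indicator_def)
      qed
    qed
  qed measurable
  also have "\<dots> = yL - yR"
    using yR yL by (subst Bochner_Integration.integral_diff) auto
  finally show ?thesis using area_derivative_translation[OF borel pos fin] by simp
qed

text \<open>
  The derivative is the length of the arc. The slope \<open>m\<close> is compared with the height of a point of
  the right half circle through the strictly increasing relation \<open>sin (arctan m) = height / \<rho>\<close>.
\<close>

lemma radius_derivative:
  "((\<lambda>r. measure lborel (E \<inter> cball 0 r)) has_real_derivative
     \<rho> * (pi - arcsin (yR / \<rho>) - arcsin (yL / \<rho>))) (at \<rho>)"
proof -
  note borel[measurable]
  let ?X = "\<lambda>m. \<rho> / sqrt (1 + m\<^sup>2)"
  have slope: "m * ?X m > y \<longleftrightarrow> m > tan (arcsin (y / \<rho>))" "m * ?X m < y \<longleftrightarrow> m < tan (arcsin (y / \<rho>))"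
       "arctan (tan (arcsin (y / \<rho>))) = arcsin (y / \<rho>)" if "\<bar>y\<bar> < \<rho>" for y m
  proof -
    have b: "- 1 < y / \<rho>" "y / \<rho> < 1" using that pos by (auto simp: field_simps abs_less_iff)
    then have a: "- (pi/2) < arcsin (y / \<rho>)" "arcsin (y / \<rho>) < pi/2"
      using arcsin_lt_bounded[of "y / \<rho>"] by auto
    then show t: "arctan (tan (arcsin (y / \<rho>))) = arcsin (y / \<rho>)" by (intro arctan_tan)
    have "m > tan (arcsin (y / \<rho>)) \<longleftrightarrow> arctan m > arcsin (y / \<rho>)" "m < tan (arcsin (y / \<rho>)) \<longleftrightarrow> arctan m < arcsin (y / \<rho>)"
      using t arctan_less_iff by metis+
    moreover have "arctan m > arcsin (y / \<rho>) \<longleftrightarrow> sin (arctan m) > sin (arcsin (y / \<rho>))"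
       "arctan m < arcsin (y / \<rho>) \<longleftrightarrow> sin (arctan m) < sin (arcsin (y / \<rho>))"
      using a arctan_bounded[of m] by (simp_all add: sin_mono_less_eq)
    moreover have "sin (arcsin (y / \<rho>)) = y / \<rho>" using b by simp
    moreover have "sin (arctan m) = m * ?X m / \<rho>" using pos by (simp add: sin_arctan)
    moreover have "y / \<rho> < m * ?X m / \<rho> \<longleftrightarrow> y < m * ?X m" "m * ?X m / \<rho> < y / \<rho> \<longleftrightarrow> m * ?X m < y"
      using pos by (simp_all add: divide_less_cancel del: times_divide_eq_right)
    ultimately show "m * ?X m > y \<longleftrightarrow> m > tan (arcsin (y / \<rho>))" "m * ?X m < y \<longleftrightarrow> m < tan (arcsin (y / \<rho>))"
      by (simp_all only:)
  qed
  define a b where "a = tan (arcsin (yR / \<rho>))" and "b = tan (arcsin (yL / \<rho>))"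
  have n: "norm (Complex (?X m) (m * ?X m)) = \<rho>" "0 < ?X m" for m
  proof -
    have s: "0 < 1 + m\<^sup>2" by (simp add: add_pos_nonneg)
    have "(?X m)\<^sup>2 + (m * ?X m)\<^sup>2 = (?X m)\<^sup>2 * (1 + m\<^sup>2)"
      by (simp only: power_mult_distrib distrib_left distrib_right mult_1_left mult_1_right mult.commute)
    also have "\<dots> = \<rho>\<^sup>2" using s by (simp add: power_divide)
    finally show "norm (Complex (?X m) (m * ?X m)) = \<rho>" using pos by (simp add: norm_complex_def)
    show "0 < ?X m" using pos s by simp
  qed
  have "(\<integral>m. \<rho> / (1 + m\<^sup>2) *
       (indicator E (Complex (?X m) (m * ?X m)) + indicator E (- Complex (?X m) (m * ?X m))) \<partial>lborel)
     = (\<integral>m. \<rho> * (indicator {a<..} m * (1 / (1 + m\<^sup>2)) + indicator {..<-b} m * (1 / (1 + m\<^sup>2))) \<partial>lborel :: real)"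
  proof (rule integral_cong_AE)
    have "AE m in lborel. m \<notin> {a, -b}"
      by (intro AE_not_in finite_imp_null_set_lborel) auto
    then show "AE m in lborel. \<rho> / (1 + m\<^sup>2) *
       (indicator E (Complex (?X m) (m * ?X m)) + indicator E (- Complex (?X m) (m * ?X m)))
      = \<rho> * (indicator {a<..} m * (1 / (1 + m\<^sup>2)) + indicator {..<-b} m * (1 / (1 + m\<^sup>2)))"
    proof eventually_elim
      case (elim m)
      have "m * ?X m \<noteq> yR" using elim slope(1,2)[OF yR, of m] by (auto simp: a_def)
      then have 1: "Complex (?X m) (m * ?X m) \<in> E \<longleftrightarrow> m > a"
        using right[OF n(1)[of m]] n(2)[of m] slope(1,2)[OF yR, of m] by (simp add: a_def)
      have "- (m * ?X m) \<noteq> yL" using elim slope(1,2)[OF yL, of "-m"] by (auto simp: b_def)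
      then have 2: "- Complex (?X m) (m * ?X m) \<in> E \<longleftrightarrow> m < - b"
        using left[of "- Complex (?X m) (m * ?X m)"] n[of m] slope(1,2)[OF yL, of "-m"] by (auto simp: b_def)
      show ?case using 1 2 by (simp add: indicator_def)
    qed
  qed measurable
  also have "\<dots> = \<rho> * ((pi / 2 - arctan a) + (pi / 2 - arctan b))"
    by (simp only: integral_mult_right_zero integral_arctan_upper_tail integral_arctan_lower_tail Bochner_Integration.integral_add)
  also have "\<dots> = \<rho> * (pi - arcsin (yR / \<rho>) - arcsin (yL / \<rho>))"
    using slope(3)[OF yR] slope(3)[OF yL] by (simp add: a_def b_def)
  finally show ?thesis using area_derivative_radius[OF borel pos fin] by simp
qed

end

text \<open>
  If the difference of the heights of the ends is fixed, then raising one end raises the other, and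
  raising both ends shortens the arc strictly. So the two derivatives of the area determine both ends.
\<close>

lemma arc_data_determine_right_end:
  assumes "\<bar>y\<bar> < \<rho>" "\<bar>x\<bar> < \<rho>" "\<bar>y'\<bar> < \<rho>" "\<bar>x'\<bar> < \<rho>"
    and diff: "x - y = x' - y'"
    and angle: "\<rho> * (pi - arcsin (y / \<rho>) - arcsin (x / \<rho>)) = \<rho> * (pi - arcsin (y' / \<rho>) - arcsin (x' / \<rho>))"
  shows "y = y'"
proof (rule ccontr)
  have pos: "0 < \<rho>" using assms(1) by linarith
  have mono: "arcsin (u / \<rho>) < arcsin (v / \<rho>)" if "u < v" "\<bar>u\<bar> < \<rho>" "\<bar>v\<bar> < \<rho>" for u v
    using that pos by (intro arcsin_less_arcsin) (auto simp: divide_simps abs_less_iff)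
  have sum: "arcsin (y / \<rho>) + arcsin (x / \<rho>) = arcsin (y' / \<rho>) + arcsin (x' / \<rho>)"
    using angle pos by simp
  assume "y \<noteq> y'"
  then consider "y < y'" "x < x'" | "y' < y" "x' < x" using diff by linarith
  then show False
    using mono[of y y'] mono[of x x'] mono[of y' y] mono[of x' x] sum assms by cases linarith+
qed

section \<open>Closed curves of unit speed\<close>

lemma no_zero_imp_same_sign:
  fixes \<psi> :: "real \<Rightarrow> real"
  assumes cont: "\<And>t. isCont \<psi> t" and nz: "\<And>t. a < t \<Longrightarrow> t \<le> b \<Longrightarrow> \<psi> t \<noteq> 0"
    and x: "a < x" "x \<le> b" "0 < \<psi> x" and y: "a < y" "y \<le> b"
  shows "0 < \<psi> y"
proof (rule ccontr)
  assume "\<not> 0 < \<psi> y"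
  then have "\<psi> y \<le> 0" by simp
  obtain z where "a < z" "z \<le> b" "\<psi> z = 0"
  proof (cases "x \<le> y")
    case True
    obtain z where "x \<le> z" "z \<le> y" "\<psi> z = 0"
      using IVT2[of \<psi> y 0 x] x \<open>\<psi> y \<le> 0\<close> cont True by (metis less_imp_le)
    then show ?thesis using that[of z] x y by linarith
  next
    case False
    then have "y \<le> x" by simp
    obtain z where "y \<le> z" "z \<le> x" "\<psi> z = 0"
      using IVT[of \<psi> y 0 x] x \<open>\<psi> y \<le> 0\<close> cont \<open>y \<le> x\<close> by (metis less_imp_le)
    then show ?thesis using that[of z] x y by linarith
  qed
  then show False using nz by blast
qed

text \<open>
  The first parameter after \<open>s\<close> at which the curve has distance \<open>r\<close> from \<open>\<gamma> s\<close>.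
\<close>

definition exit_time :: "(real \<Rightarrow> complex) \<Rightarrow> real \<Rightarrow> real \<Rightarrow> real" where
  "exit_time \<gamma> s r = Inf {t. s \<le> t \<and> r \<le> dist (\<gamma> s) (\<gamma> t)}"

text \<open>
  A closed simple unit-speed curve is described by its periodic extension to the real line, so that
  no base point is distinguished and one can follow the curve beyond one period.
\<close>

locale closed_curve =
  fixes L :: real and \<gamma> T :: "real \<Rightarrow> complex"
  assumes L: "0 < L" and per: "\<gamma> (t + L) = \<gamma> t" and perT: "T (t + L) = T t"
    and deriv: "(\<gamma> has_vector_derivative T t) (at t)" and contT: "isCont T t"
    and unit: "norm (T t) = 1"
    and inj: "\<gamma> s = \<gamma> t \<Longrightarrow> \<bar>s - t\<bar> < L \<Longrightarrow> s = t"
begin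

lemma isCont_curve: "isCont \<gamma> t"
  using deriv has_vector_derivative_continuous by blast

lemma continuous_on_curve: "continuous_on S \<gamma>"
  by (simp add: continuous_at_imp_continuous_on isCont_curve)

lemma continuous_on_dist: "continuous_on S (\<lambda>t. dist (\<gamma> s) (\<gamma> t))"
  by (intro continuous_intros continuous_on_curve)

lemma periodic_int: "\<gamma> (t + of_int k * L) = \<gamma> t"
proof -
  have n: "\<gamma> (t + real n * L) = \<gamma> t" for n t
  proof (induction n)
    case (Suc n)
    have "t + real (Suc n) * L = (t + real n * L) + L" by (simp add: algebra_simps)
    then show ?case using Suc by (simp only: per)
  qed simp
  show ?thesis
  proof (cases "0 \<le> k")
    case True
    then show ?thesis using n[of t "nat k"] by simp
  next
    case False
    then show ?thesis using n[of "t + of_int k * L" "nat (-k)"] by simp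
  qed
qed

lemma range_representative: "\<exists>t'. s \<le> t' \<and> t' < s + L \<and> \<gamma> t' = \<gamma> t"
proof -
  define k where "k = \<lfloor>(t - s) / L\<rfloor>"
  have "of_int k \<le> (t - s) / L" "(t - s) / L < of_int k + 1" by (auto simp: k_def)
  then have "of_int k * L \<le> t - s" "t - s < of_int k * L + L"
    using L by (auto simp: field_simps)
  moreover have "\<gamma> (t + of_int (-k) * L) = \<gamma> t" by (rule periodic_int)
  ultimately show ?thesis by (intro exI[of _ "t + of_int (-k) * L"]) auto
qed

lemma dist_le: "dist (\<gamma> x) (\<gamma> y) \<le> \<bar>x - y\<bar>"
proof -
  have "norm (\<gamma> x - \<gamma> y) \<le> 1 * norm (x - y)"
  proof (rule differentiable_bound[of UNIV \<gamma> "\<lambda>t h. h *\<^sub>R T t"])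
    show "(\<gamma> has_derivative (\<lambda>h. h *\<^sub>R T t)) (at t)" for t
      using deriv[of t] by (simp add: has_vector_derivative_def)
    show "onorm (\<lambda>h. h *\<^sub>R T t) \<le> 1" for t
      by (rule onorm_bound) (simp_all add: unit)
  qed auto
  then show ?thesis by (simp add: dist_norm)
qed

text \<open>
  On short intervals the tangent is nearly constant, so by the mean value inequality arcs are almost
  as short as their chords.
\<close>

lemma local_near_isometry:
  assumes "0 < \<epsilon>"
  shows "\<exists>\<delta>>0. \<forall>x\<in>{a..b}. \<forall>y\<in>{a..b}. \<bar>x - y\<bar> < \<delta> \<longrightarrow> (1 - \<epsilon>) * \<bar>x - y\<bar> \<le> dist (\<gamma> x) (\<gamma> y)"
proof -
  have "uniformly_continuous_on {a..b} T"
    by (intro compact_uniformly_continuous continuous_at_imp_continuous_on) (auto simp: contT)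
  then obtain \<delta> where \<delta>: "0 < \<delta>" "\<And>x y. x \<in> {a..b} \<Longrightarrow> y \<in> {a..b} \<Longrightarrow> dist x y < \<delta> \<Longrightarrow> dist (T x) (T y) < \<epsilon>"
    using assms unfolding uniformly_continuous_on_def by (metis dist_commute)
  have "(1 - \<epsilon>) * \<bar>x - y\<bar> \<le> dist (\<gamma> x) (\<gamma> y)" if xy: "x \<in> {a..b}" "y \<in> {a..b}" "\<bar>x - y\<bar> < \<delta>" for x y
  proof -
    have "norm ((\<gamma> x - x *\<^sub>R T y) - (\<gamma> y - y *\<^sub>R T y)) \<le> \<epsilon> * norm (x - y)"
    proof (rule differentiable_bound[of "closed_segment x y" "\<lambda>t. \<gamma> t - t *\<^sub>R T y" "\<lambda>t h. h *\<^sub>R (T t - T y)"])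
      fix t assume t: "t \<in> closed_segment x y"
      show "((\<lambda>t. \<gamma> t - t *\<^sub>R T y) has_derivative (\<lambda>h. h *\<^sub>R (T t - T y))) (at t within closed_segment x y)"
      proof -
        have "((\<lambda>t. \<gamma> t - t *\<^sub>R T y) has_derivative (\<lambda>h. h *\<^sub>R T t - h *\<^sub>R T y)) (at t)"
          using deriv[of t] unfolding has_vector_derivative_def
          by (intro has_derivative_diff has_derivative_scaleR_left has_derivative_ident)
        then show ?thesis by (simp add: scaleR_diff_right has_derivative_at_withinI)
      qed
      have "t \<in> {a..b}" "dist t y < \<delta>"
        using t xy by (auto simp: closed_segment_eq_real_ivl dist_real_def split: if_splits)
      then have "norm (T t - T y) \<le> \<epsilon>" using \<delta>(2)[of t y] xy by (simp add: dist_norm)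
      then show "onorm (\<lambda>h. h *\<^sub>R (T t - T y)) \<le> \<epsilon>"
        using assms by (intro onorm_bound) (simp_all add: mult.commute[of \<epsilon>] mult_left_mono)
    qed auto
    then have "norm ((\<gamma> x - \<gamma> y) - (x - y) *\<^sub>R T y) \<le> \<epsilon> * \<bar>x - y\<bar>" by (simp add: algebra_simps)
    moreover have "norm ((x - y) *\<^sub>R T y) = \<bar>x - y\<bar>" by (simp add: unit)
    ultimately show ?thesis
      using norm_triangle_ineq2[of "(x - y) *\<^sub>R T y" "\<gamma> x - \<gamma> y"] by (simp add: dist_norm norm_minus_commute algebra_simps)
  qed
  then show ?thesis using \<delta>(1) by blast
qed

lemma dist_sq_deriv:
  "((\<lambda>t. (dist (\<gamma> s) (\<gamma> t))\<^sup>2) has_real_derivative 2 * ((\<gamma> t - \<gamma> s) \<bullet> T t)) (at t)"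
proof -
  have "((\<lambda>t. (\<gamma> t - \<gamma> s) \<bullet> (\<gamma> t - \<gamma> s)) has_derivative (\<lambda>h. (\<gamma> t - \<gamma> s) \<bullet> (h *\<^sub>R T t) + (h *\<^sub>R T t) \<bullet> (\<gamma> t - \<gamma> s))) (at t)"
    using deriv[of t] unfolding has_vector_derivative_def
    by (intro has_derivative_inner) (auto intro!: derivative_eq_intros)
  then have "((\<lambda>t. (\<gamma> t - \<gamma> s) \<bullet> (\<gamma> t - \<gamma> s)) has_derivative (*) (2 * ((\<gamma> t - \<gamma> s) \<bullet> T t))) (at t)"
    by (rule has_derivative_eq_rhs) (auto simp: inner_commute fun_eq_iff)
  then show ?thesis
    by (simp add: has_field_derivative_def dist_norm norm_minus_commute power2_norm_eq_inner)
qed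

lemma chord_deriv: "((\<lambda>t. (\<gamma> t - \<gamma> s) \<bullet> v) has_real_derivative (T t \<bullet> v)) (at t)"
proof -
  have "((\<lambda>t. (\<gamma> t - \<gamma> s) \<bullet> v) has_derivative (\<lambda>h. (h *\<^sub>R T t - 0) \<bullet> v)) (at t)"
    using deriv[of t] unfolding has_vector_derivative_def
    by (intro has_derivative_inner_left has_derivative_diff has_derivative_const)
  then show ?thesis
    unfolding has_field_derivative_def by (rule has_derivative_eq_rhs) (simp add: fun_eq_iff mult.commute)
qed

end

section \<open>Exit times of graph-like curves\<close>

text \<open>
  The condition says that the distance from \<open>\<gamma> s\<close> has no critical point on the part of the curve
  in the closed disk of radius \<open>R\<close> except \<open>\<gamma> s\<close> itself. With the roles of \<open>s\<close> and \<open>t\<close>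
  exchanged it says that the normal line at \<open>\<gamma> s\<close> does not meet this part of the curve again.
  In this form the tangentially graph-like condition enters the reconstruction.
\<close>

locale graphlike_curve = closed_curve +
  fixes R :: real
  assumes R: "0 < R"
    and no_critical: "\<gamma> s \<noteq> \<gamma> t \<Longrightarrow> dist (\<gamma> s) (\<gamma> t) \<le> R \<Longrightarrow> (\<gamma> t - \<gamma> s) \<bullet> T t \<noteq> 0"
begin

abbreviation "exit \<equiv> exit_time \<gamma>"

text \<open>
  Reversing the direction of the curve turns every statement about the arc after \<open>s\<close> into one about
  the arc before \<open>s\<close>.
\<close>

lemma graphlike_reverse: "graphlike_curve L (\<lambda>t. \<gamma> (- t)) (\<lambda>t. - T (- t)) R"
proof
  show "\<gamma> (- (t + L)) = \<gamma> (- t)" for t using per[of "- t - L"] by simp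
  show "- T (- (t + L)) = - T (- t)" for t using perT[of "- t - L"] by simp
  show "((\<lambda>t. \<gamma> (- t)) has_vector_derivative - T (- t)) (at t)" for t
  proof -
    have "(uminus has_vector_derivative (-1)) (at t)" by (auto intro!: derivative_eq_intros)
    then have "((\<gamma> \<circ> uminus) has_vector_derivative (-1) *\<^sub>R T (- t)) (at t)"
      by (rule vector_diff_chain_at) (rule deriv)
    then show ?thesis by (simp add: o_def)
  qed
  show "isCont (\<lambda>t. - T (- t)) t" for t
    by (intro continuous_intros isCont_o2[of _ uminus T] contT)
  show "s = t" if "\<gamma> (- s) = \<gamma> (- t)" "\<bar>s - t\<bar> < L" for s t
    using inj[OF that(1)] that(2) by simp
  show "(\<gamma> (- t) - \<gamma> (- s)) \<bullet> - T (- t) \<noteq> 0" if "\<gamma> (- s) \<noteq> \<gamma> (- t)" "dist (\<gamma> (- s)) (\<gamma> (- t)) \<le> R" for s t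
    using no_critical[OF that] by simp
qed (use L unit R in auto)

lemma critical_point_far:
  assumes "\<gamma> s \<noteq> \<gamma> t" "a < t" "t < b"
    and ext: "(\<forall>x\<in>{a<..<b}. dist (\<gamma> s) (\<gamma> x) \<le> dist (\<gamma> s) (\<gamma> t)) \<or> (\<forall>x\<in>{a<..<b}. dist (\<gamma> s) (\<gamma> t) \<le> dist (\<gamma> s) (\<gamma> x))"
  shows "R < dist (\<gamma> s) (\<gamma> t)"
proof -
  define d where "d = min (t - a) (b - t)"
  have d: "0 < d" "\<And>x. \<bar>t - x\<bar> < d \<Longrightarrow> x \<in> {a<..<b}" using assms by (auto simp: d_def)
  have sq: "(dist (\<gamma> s) (\<gamma> x))\<^sup>2 \<le> (dist (\<gamma> s) (\<gamma> y))\<^sup>2 \<longleftrightarrow> dist (\<gamma> s) (\<gamma> x) \<le> dist (\<gamma> s) (\<gamma> y)" for x y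
    by (simp add: abs_le_square_iff[symmetric])
  have "2 * ((\<gamma> t - \<gamma> s) \<bullet> T t) = 0"
    using ext
  proof
    assume "\<forall>x\<in>{a<..<b}. dist (\<gamma> s) (\<gamma> x) \<le> dist (\<gamma> s) (\<gamma> t)"
    then show ?thesis using d by (intro DERIV_local_max[OF dist_sq_deriv, of d]) (auto simp: sq)
  next
    assume "\<forall>x\<in>{a<..<b}. dist (\<gamma> s) (\<gamma> t) \<le> dist (\<gamma> s) (\<gamma> x)"
    then show ?thesis using d by (intro DERIV_local_min[OF dist_sq_deriv, of d]) (auto simp: sq)
  qed
  then show ?thesis using no_critical[OF assms(1)] by force
qed

text \<open>
  A point of the curve farthest from \<open>\<gamma> s\<close> is critical for the distance, so it is outside the disk.
\<close>

lemma exists_far: "\<exists>t. s < t \<and> t < s + L \<and> R < dist (\<gamma> s) (\<gamma> t)"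
proof -
  obtain t where t: "t \<in> {s..s + L}" "\<And>x. x \<in> {s..s + L} \<Longrightarrow> dist (\<gamma> s) (\<gamma> x) \<le> dist (\<gamma> s) (\<gamma> t)"
    using continuous_attains_sup[OF _ _ continuous_on_dist, of "{s..s+L}" s] L by auto
  have "\<gamma> s \<noteq> \<gamma> (s + L / 2)" using inj[of s "s + L / 2"] L by auto
  then have "0 < dist (\<gamma> s) (\<gamma> (s + L / 2))" by simp
  also have "\<dots> \<le> dist (\<gamma> s) (\<gamma> t)" using L by (intro t(2)) auto
  finally have "0 < dist (\<gamma> s) (\<gamma> t)" .
  then have ne: "\<gamma> s \<noteq> \<gamma> t" by simp
  then have "t \<noteq> s" "t \<noteq> s + L" using per[of s] by auto
  then have st: "s < t" "t < s + L" using t(1) by auto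
  have "R < dist (\<gamma> s) (\<gamma> t)"
    by (rule critical_point_far[OF ne st]) (use t in auto)
  then show ?thesis using st by blast
qed

lemma exit_props:
  assumes r: "0 \<le> r" "r \<le> R"
  shows "s \<le> exit s r" "exit s r < s + L" "dist (\<gamma> s) (\<gamma> (exit s r)) = r"
    and "\<And>t. s \<le> t \<Longrightarrow> r \<le> dist (\<gamma> s) (\<gamma> t) \<Longrightarrow> exit s r \<le> t"
proof -
  let ?S = "{t. s \<le> t \<and> r \<le> dist (\<gamma> s) (\<gamma> t)}"
  obtain t0 where t0: "s < t0" "t0 < s + L" "R < dist (\<gamma> s) (\<gamma> t0)" using exists_far by blast
  have bdd: "bdd_below ?S" by (rule bdd_belowI[of _ s]) auto
  have ne: "t0 \<in> ?S" using t0 r by auto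
  have "closed {t. s \<le> t}" "closed {t. r \<le> dist (\<gamma> s) (\<gamma> t)}"
    by (intro closed_Collect_le continuous_intros continuous_on_curve)+
  then have "closed ?S" by (simp add: closed_Collect_conj)
  then have mem: "exit s r \<in> ?S"
    unfolding exit_time_def using closed_contains_Inf[of ?S] bdd ne by blast
  show least: "exit s r \<le> t" if "s \<le> t" "r \<le> dist (\<gamma> s) (\<gamma> t)" for t
    unfolding exit_time_def using that bdd by (intro cInf_lower) auto
  show s: "s \<le> exit s r" using mem by simp
  show "exit s r < s + L" using least[of t0] t0 r by auto
  show "dist (\<gamma> s) (\<gamma> (exit s r)) = r"
  proof -
    have "\<exists>x. s \<le> x \<and> x \<le> exit s r \<and> dist (\<gamma> s) (\<gamma> x) = r"
      by (rule IVT') (use mem r s continuous_on_dist in auto)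
    then obtain x where "s \<le> x" "x \<le> exit s r" "dist (\<gamma> s) (\<gamma> x) = r" by blast
    moreover from this have "exit s r \<le> x" using least[of x] by auto
    ultimately show ?thesis by auto
  qed
qed

lemma exit_mono_radius: "0 \<le> r \<Longrightarrow> r \<le> r' \<Longrightarrow> r' \<le> R \<Longrightarrow> exit s r \<le> exit s r'"
  using exit_props[of r s] exit_props[of r' s] by auto

lemma exit_gt: "0 < r \<Longrightarrow> r \<le> R \<Longrightarrow> s < exit s r"
  using exit_props[of r s] by (cases "exit s r = s") auto

lemma forward_injective: "s < t \<Longrightarrow> t \<le> exit s R \<Longrightarrow> \<gamma> s \<noteq> \<gamma> t"
  using inj[of s t] exit_props(2)[of R s] R by auto

lemma forward_dist_le:
  assumes "s \<le> t" "t \<le> exit s R"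
  shows "dist (\<gamma> s) (\<gamma> t) \<le> R"
proof (rule ccontr)
  assume far: "\<not> dist (\<gamma> s) (\<gamma> t) \<le> R"
  then have "exit s R \<le> t" using exit_props(4)[of R s t] assms R by simp
  then have "t = exit s R" using assms by simp
  then show False using far exit_props(3)[of R s] R by simp
qed

text \<open>
  Both quantities vanish nowhere on the arc, so they have constant sign. The first cannot be negative,
  since the distance would decrease from \<open>0\<close>; the second has derivative \<open>1\<close> at \<open>s\<close>.
\<close>

lemma forward_pos:
  assumes t: "s < t" "t \<le> exit s R"
  shows "0 < (\<gamma> t - \<gamma> s) \<bullet> T t" "0 < (\<gamma> t - \<gamma> s) \<bullet> T s"
proof -
  have c: "isCont (\<lambda>t. (\<gamma> t - \<gamma> s) \<bullet> T t) t" "isCont (\<lambda>t. (\<gamma> t - \<gamma> s) \<bullet> T s) t" for t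
    by (intro continuous_intros isCont_curve contT)+
  have nz: "(\<gamma> t - \<gamma> s) \<bullet> T t \<noteq> 0" "(\<gamma> t - \<gamma> s) \<bullet> T s \<noteq> 0" if "s < t" "t \<le> exit s R" for t
  proof -
    show "(\<gamma> t - \<gamma> s) \<bullet> T t \<noteq> 0"
      using no_critical[of s t] forward_injective[OF that] forward_dist_le[of s t] that by auto
    show "(\<gamma> t - \<gamma> s) \<bullet> T s \<noteq> 0"
      using no_critical[of t s] forward_injective[OF that] forward_dist_le[of s t] that
      by (auto simp: dist_commute inner_diff_left)
  qed
  show "0 < (\<gamma> t - \<gamma> s) \<bullet> T t"
  proof (rule ccontr)
    assume neg: "\<not> 0 < (\<gamma> t - \<gamma> s) \<bullet> T t"
    have all: "(\<gamma> x - \<gamma> s) \<bullet> T x < 0" if "s < x" "x \<le> t" for x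
      using no_zero_imp_same_sign[OF c(1) nz(1), of s "exit s R" x t] neg nz(1)[of x] that t by fastforce
    have "(dist (\<gamma> s) (\<gamma> t))\<^sup>2 < (dist (\<gamma> s) (\<gamma> s))\<^sup>2"
    proof (rule DERIV_neg_imp_decreasing_open[OF t(1), of "\<lambda>t. (dist (\<gamma> s) (\<gamma> t))\<^sup>2"])
      show "continuous_on {s..t} (\<lambda>t. (dist (\<gamma> s) (\<gamma> t))\<^sup>2)"
        by (intro continuous_intros continuous_on_curve)
    next
      fix x assume x: "s < x" "x < t"
      then show "\<exists>y. ((\<lambda>t. (dist (\<gamma> s) (\<gamma> t))\<^sup>2) has_real_derivative y) (at x) \<and> y < 0"
        using all[of x] by (intro exI[of _ "2 * ((\<gamma> x - \<gamma> s) \<bullet> T x)"] conjI dist_sq_deriv) auto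
    qed
    then show False by simp
  qed
  obtain d where d: "0 < d" "\<And>h. 0 < h \<Longrightarrow> h < d \<Longrightarrow> (\<gamma> s - \<gamma> s) \<bullet> T s < (\<gamma> (s + h) - \<gamma> s) \<bullet> T s"
    using DERIV_pos_inc_right[OF chord_deriv[of s "T s" s]] unit[of s] by (auto simp: dot_square_norm)
  have "0 < (\<gamma> (s + min (d/2) (t - s)) - \<gamma> s) \<bullet> T s"
    using d(2)[of "min (d/2) (t - s)"] d(1) t by auto
  then show "0 < (\<gamma> t - \<gamma> s) \<bullet> T s"
    by (rule no_zero_imp_same_sign[OF c(2) nz(2), of s "exit s R" _ t, rotated 4]) (use t d in auto)
qed

lemma dist_strict_mono:
  assumes "s \<le> t" "t < t'" "t' \<le> exit s R"
  shows "dist (\<gamma> s) (\<gamma> t) < dist (\<gamma> s) (\<gamma> t')"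
proof -
  have "(dist (\<gamma> s) (\<gamma> t))\<^sup>2 < (dist (\<gamma> s) (\<gamma> t'))\<^sup>2"
  proof (rule DERIV_pos_imp_increasing_open[OF assms(2), of "\<lambda>t. (dist (\<gamma> s) (\<gamma> t))\<^sup>2"])
    show "continuous_on {t..t'} (\<lambda>t. (dist (\<gamma> s) (\<gamma> t))\<^sup>2)"
      by (intro continuous_intros continuous_on_curve)
  next
    fix x assume x: "t < x" "x < t'"
    then show "\<exists>y. ((\<lambda>t. (dist (\<gamma> s) (\<gamma> t))\<^sup>2) has_real_derivative y) (at x) \<and> 0 < y"
      using forward_pos(1)[of s x] assms
      by (intro exI[of _ "2 * ((\<gamma> x - \<gamma> s) \<bullet> T x)"] conjI dist_sq_deriv) auto
  qed
  then show ?thesis by (rule power2_less_imp_less) simp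
qed

lemma exit_of_dist:
  assumes "s \<le> t" "t \<le> exit s R"
  shows "exit s (dist (\<gamma> s) (\<gamma> t)) = t"
proof -
  let ?r = "dist (\<gamma> s) (\<gamma> t)"
  have r: "0 \<le> ?r" "?r \<le> R" using forward_dist_le[OF assms] by auto
  have "exit s ?r \<le> t" using exit_props(4)[OF r, of s t] assms by auto
  moreover have "\<not> exit s ?r < t"
    using dist_strict_mono[of s "exit s ?r" t] exit_props[OF r, of s] assms by auto
  ultimately show ?thesis by simp
qed

lemma exit_continuous_radius: "continuous_on {0..R} (exit s)"
proof -
  have "continuous_on ((\<lambda>t. dist (\<gamma> s) (\<gamma> t)) ` {s..exit s R}) (exit s)"
    by (rule continuous_on_inv[OF continuous_on_dist]) (auto simp: exit_of_dist)
  moreover have "{0..R} \<subseteq> (\<lambda>t. dist (\<gamma> s) (\<gamma> t)) ` {s..exit s R}"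
  proof
    fix r assume r: "r \<in> {0..R}"
    then have "r = dist (\<gamma> s) (\<gamma> (exit s r))" "exit s r \<in> {s..exit s R}"
      using exit_props[of r s] exit_mono_radius[of r R s] by auto
    then show "r \<in> (\<lambda>t. dist (\<gamma> s) (\<gamma> t)) ` {s..exit s R}" by blast
  qed
  ultimately show ?thesis by (rule continuous_on_subset)
qed

text \<open>
  Moving the starting point forward shortens the chord to a fixed later point \<open>t\<close> of the arc. It
  does so at first, and if the chord recovered its length, the distance from \<open>\<gamma> t\<close> would have a
  minimum in between, a critical point inside the disk.
\<close>

lemma dist_decreasing_in_start:
  assumes "s < s'" "s' < t" "t \<le> exit s R"
  shows "dist (\<gamma> s') (\<gamma> t) < dist (\<gamma> s) (\<gamma> t)"
proof (rule ccontr)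
  assume "\<not> ?thesis"
  then have ge: "dist (\<gamma> t) (\<gamma> s) \<le> dist (\<gamma> t) (\<gamma> s')" by (simp add: dist_commute)
  have "2 * ((\<gamma> s - \<gamma> t) \<bullet> T s) < 0" using forward_pos(2)[of s t] assms by (simp add: inner_diff_left)
  then obtain d where d: "0 < d" "\<And>h. 0 < h \<Longrightarrow> h < d \<Longrightarrow> (dist (\<gamma> t) (\<gamma> s))\<^sup>2 > (dist (\<gamma> t) (\<gamma> (s + h)))\<^sup>2"
    using DERIV_neg_dec_right[OF dist_sq_deriv[of t s]] by auto
  define s1 where "s1 = s + min (d / 2) (s' - s)"
  have "(dist (\<gamma> t) (\<gamma> s1))\<^sup>2 < (dist (\<gamma> t) (\<gamma> s))\<^sup>2"
    unfolding s1_def by (rule d(2)) (use d(1) assms in auto)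
  then have s1: "dist (\<gamma> t) (\<gamma> s1) < dist (\<gamma> t) (\<gamma> s)" "s1 \<in> {s..s'}"
    using d(1) assms by (auto intro: power2_less_imp_less simp: s1_def)
  obtain m where m: "m \<in> {s..s'}" "\<And>x. x \<in> {s..s'} \<Longrightarrow> dist (\<gamma> t) (\<gamma> m) \<le> dist (\<gamma> t) (\<gamma> x)"
    using continuous_attains_inf[OF _ _ continuous_on_dist, of "{s..s'}" t] assms by auto
  have lt: "dist (\<gamma> t) (\<gamma> m) < dist (\<gamma> t) (\<gamma> s)" using m(2)[OF s1(2)] s1(1) by simp
  then have "m \<noteq> s" "m \<noteq> s'" using ge by auto
  then have ms: "s < m" "m < s'" using m(1) by auto
  have ne: "\<gamma> t \<noteq> \<gamma> m"
    using inj[of t m] ms assms exit_props(2)[of R s] R by auto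
  have "R < dist (\<gamma> t) (\<gamma> m)"
    by (rule critical_point_far[OF ne ms]) (use m in auto)
  then show False using lt forward_dist_le[of s t] assms by (simp add: dist_commute)
qed

lemma exit_mono: "s \<le> s' \<Longrightarrow> exit s R \<le> exit s' R"
proof (rule ccontr)
  assume "s \<le> s'" "\<not> exit s R \<le> exit s' R"
  then have s: "s < s'" and lt: "exit s' R < exit s R" by (auto simp: le_less)
  have e: "s' < exit s' R" using exit_gt[of R s'] R by simp
  have "R < dist (\<gamma> s) (\<gamma> (exit s' R))"
    using dist_decreasing_in_start[OF s e] lt exit_props(3)[of R s'] R by simp
  then show False using forward_dist_le[of s "exit s' R"] s e lt by simp
qed

text \<open>
  The distance from \<open>\<gamma> s\<close> crosses the value \<open>R\<close> at the exit with positive derivative, and it changes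
  by at most \<open>\<bar>s' - s\<bar>\<close> when \<open>s\<close> is replaced by \<open>s'\<close>; so the crossing persists nearby.
\<close>

lemma isCont_exit: "isCont (\<lambda>s. exit s R) s"
  unfolding continuous_at_eps_delta
proof (intro allI impI)
  fix \<epsilon> :: real assume \<epsilon>: "0 < \<epsilon>"
  define e where "e = exit s R"
  have e: "s < e" "dist (\<gamma> s) (\<gamma> e) = R" using exit_gt[of R s] exit_props[of R s] R by (auto simp: e_def)
  have "0 < 2 * ((\<gamma> e - \<gamma> s) \<bullet> T e)" using forward_pos(1)[of s e] e by (simp add: e_def)
  then obtain d where d: "0 < d" "\<And>h. 0 < h \<Longrightarrow> h < d \<Longrightarrow> (dist (\<gamma> s) (\<gamma> e))\<^sup>2 < (dist (\<gamma> s) (\<gamma> (e + h)))\<^sup>2"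
    using DERIV_pos_inc_right[OF dist_sq_deriv[of s e]] by auto
  define t1 where "t1 = e + min (d / 2) (\<epsilon> / 2)"
  have "(dist (\<gamma> s) (\<gamma> e))\<^sup>2 < (dist (\<gamma> s) (\<gamma> t1))\<^sup>2"
    unfolding t1_def by (rule d(2)) (use d(1) \<epsilon> in auto)
  then have t1: "R < dist (\<gamma> s) (\<gamma> t1)" "e < t1" "t1 < e + \<epsilon>"
    using d(1) \<epsilon> e by (auto intro: power2_less_imp_less simp: t1_def)
  define t0 where "t0 = max s (e - \<epsilon> / 2)"
  have t0: "s \<le> t0" "t0 < e" "e - \<epsilon> < t0" using \<epsilon> e by (auto simp: t0_def)
  have m: "dist (\<gamma> s) (\<gamma> t0) < R" using dist_strict_mono[of s t0 e] t0 e by (simp add: e_def)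
  \<comment> \<open>The bounds, in this order, keep the later point outside the disk, keep it after \<open>s'\<close>, keep the
      earlier point inside, and exclude an exit before \<open>s\<close>.\<close>
  define \<delta> where "\<delta> = Min {dist (\<gamma> s) (\<gamma> t1) - R, t1 - s, R - dist (\<gamma> s) (\<gamma> t0), R}"
  have \<delta>: "0 < \<delta>" "\<delta> \<le> dist (\<gamma> s) (\<gamma> t1) - R" "\<delta> \<le> t1 - s" "\<delta> \<le> R - dist (\<gamma> s) (\<gamma> t0)" "\<delta> \<le> R"
    unfolding \<delta>_def by (subst Min_gr_iff; use t1 m R e in simp) (rule Min_le; simp)+
  have "\<bar>exit s' R - e\<bar> < \<epsilon>" if s': "\<bar>s' - s\<bar> < \<delta>" for s'
  proof -
    have lip: "\<bar>dist (\<gamma> s') (\<gamma> t) - dist (\<gamma> s) (\<gamma> t)\<bar> < \<delta>" for t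
      using dist_le[of s' s] dist_triangle[of "\<gamma> s'" "\<gamma> t" "\<gamma> s"] dist_triangle[of "\<gamma> s" "\<gamma> t" "\<gamma> s'"] s'
      by (auto simp: dist_commute abs_if)
    have "exit s' R \<le> t1"
      by (rule exit_props(4)) (use lip[of t1] \<delta> s' R in auto)
    moreover have "t0 \<le> exit s' R"
    proof (rule ccontr)
      assume "\<not> t0 \<le> exit s' R"
      then have lt: "exit s' R < t0" by simp
      have R': "dist (\<gamma> s') (\<gamma> (exit s' R)) = R" "s' \<le> exit s' R" using exit_props[of R s'] R by auto
      show False
      proof (cases "s \<le> exit s' R")
        case True
        then have "dist (\<gamma> s) (\<gamma> (exit s' R)) < dist (\<gamma> s) (\<gamma> t0)"
          using dist_strict_mono[of s "exit s' R" t0] lt t0 by (simp add: e_def)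
        then show False using lip[of "exit s' R"] R' \<delta> by linarith
      next
        case False
        then show False using dist_le[of s' "exit s' R"] R' s' \<delta> by linarith
      qed
    qed
    ultimately show ?thesis using t0 t1 by linarith
  qed
  then show "\<exists>\<delta>>0. \<forall>x. dist x s < \<delta> \<longrightarrow> dist (exit x R) (exit s R) < \<epsilon>"
    using \<delta>(1) by (auto simp: e_def dist_real_def)
qed

text \<open>
  The last parameter before \<open>s\<close> at distance \<open>r\<close> is an exit time of the reversed curve.
\<close>

abbreviation "entry s r \<equiv> - exit_time (\<lambda>t. \<gamma> (- t)) (- s) r"

lemma entry_props:
  assumes "0 \<le> r" "r \<le> R"
  shows "entry s r \<le> s" "s - L < entry s r" "dist (\<gamma> s) (\<gamma> (entry s r)) = r"
proof -
  interpret rev: graphlike_curve L "\<lambda>t. \<gamma> (- t)" "\<lambda>t. - T (- t)" R by (rule graphlike_reverse)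
  show "entry s r \<le> s" "s - L < entry s r" "dist (\<gamma> s) (\<gamma> (entry s r)) = r"
    using rev.exit_props[OF assms, of "- s"] by auto
qed

lemma entry_mono_radius: "0 \<le> r \<Longrightarrow> r \<le> r' \<Longrightarrow> r' \<le> R \<Longrightarrow> entry s r' \<le> entry s r"
  using graphlike_curve.exit_mono_radius[OF graphlike_reverse] by simp

lemma entry_less: "0 < r \<Longrightarrow> r \<le> R \<Longrightarrow> entry s r < s"
  using graphlike_curve.exit_gt[OF graphlike_reverse, of r "- s"] by simp

lemma backward_neg:
  assumes "t < s" "entry s R \<le> t"
  shows "(\<gamma> t - \<gamma> s) \<bullet> T s < 0"
  using graphlike_curve.forward_pos(2)[OF graphlike_reverse, of "- s" "- t"] assms by simp

lemma entry_of_dist: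
  assumes "t \<le> s" "entry s R \<le> t"
  shows "entry s (dist (\<gamma> s) (\<gamma> t)) = t"
  using graphlike_curve.exit_of_dist[OF graphlike_reverse, of "- s" "- t"] assms by simp

text \<open>
  The curve does not return to the disk between leaving it and entering it again one period later:
  a point nearest to \<open>\<gamma> s\<close> on that part would be critical.
\<close>

lemma close_points_on_arc:
  assumes "dist (\<gamma> s) (\<gamma> t) \<le> R"
  obtains t' where "\<gamma> t' = \<gamma> t" "entry s R \<le> t'" "t' \<le> exit s R"
proof -
  let ?e = "exit s R" and ?b = "entry s R + L"
  have e: "s < ?e" "?e < s + L" "dist (\<gamma> s) (\<gamma> ?e) = R" using exit_gt[of R s] exit_props[of R s] R by auto
  have "\<gamma> ?b = \<gamma> (entry s R)" by (rule per)
  then have b: "s < ?b" "?b < s + L" "dist (\<gamma> s) (\<gamma> ?b) = R"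
    using entry_less[of R s] entry_props[of R s] R by auto
  obtain t' where t': "s \<le> t'" "t' < s + L" "\<gamma> t' = \<gamma> t" using range_representative by blast
  have outside: "R < dist (\<gamma> s) (\<gamma> x)" if x: "?e < x" "x < ?b" for x
  proof (rule ccontr)
    assume le: "\<not> R < dist (\<gamma> s) (\<gamma> x)"
    obtain m where m: "m \<in> {?e..?b}" "\<And>y. y \<in> {?e..?b} \<Longrightarrow> dist (\<gamma> s) (\<gamma> m) \<le> dist (\<gamma> s) (\<gamma> y)"
      using continuous_attains_inf[OF _ _ continuous_on_dist, of "{?e..?b}" s] x by auto
    \<comment> \<open>A minimum at an end point has the value \<open>R\<close>; then \<open>x\<close> is an interior minimum as well.\<close>
    define m' where "m' = (if m = ?e \<or> m = ?b then x else m)"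
    have mm': "dist (\<gamma> s) (\<gamma> m') \<le> dist (\<gamma> s) (\<gamma> m)"
      using le e b by (auto simp: m'_def)
    have m': "?e < m'" "m' < ?b" using x m by (auto simp: m'_def)
    have ne: "\<gamma> s \<noteq> \<gamma> m'" using inj[of s m'] m' e b by auto
    have "R < dist (\<gamma> s) (\<gamma> m')"
      by (rule critical_point_far[OF ne m']) (use m(2) mm' in \<open>force intro: order_trans\<close>)
    moreover have "dist (\<gamma> s) (\<gamma> m) \<le> dist (\<gamma> s) (\<gamma> x)" using m(2)[of x] x by simp
    ultimately show False using mm' le by linarith
  qed
  consider "t' \<le> ?e" | "?b \<le> t'" using outside[of t'] assms t'(3) by force
  then show ?thesis
  proof cases
    case 1
    then show ?thesis using that[of t'] t' b by auto
  next
    case 2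
    have "\<gamma> (t' - L) = \<gamma> t" using per[of "t' - L"] t'(3) by simp
    then show ?thesis using that[of "t' - L"] 2 t' e by auto
  qed
qed

lemma circle_meets_curve:
  assumes r: "0 < r" "r \<le> R" and t: "dist (\<gamma> s) (\<gamma> t) = r"
  shows "\<gamma> t = \<gamma> (exit s r) \<or> \<gamma> t = \<gamma> (entry s r)"
proof -
  obtain t' where t': "\<gamma> t' = \<gamma> t" "entry s R \<le> t'" "t' \<le> exit s R"
    using close_points_on_arc[of s t] t r by auto
  show ?thesis
    using exit_of_dist[of s t'] entry_of_dist[of t' s] t' t by (cases "s \<le> t'") auto
qed

end

section \<open>The region inside the curve, seen from a boundary point\<close>

lemma connected_avoiding_frontier:
  assumes "connected S" "S \<inter> frontier E = {}" "x \<in> S" "y \<in> S"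
  shows "x \<in> E \<longleftrightarrow> y \<in> E"
  using connected_Int_frontier[OF assms(1), of E] assms by blast

text \<open>
  A half circle that meets the frontier of \<open>E\<close> only at height \<open>y0\<close> falls into two connected arcs on
  which membership in \<open>E\<close> is constant. The sign \<open>\<sigma>\<close> selects the right or the left half circle.
\<close>

lemma half_circle_sides:
  fixes E :: "complex set" and \<sigma> r y0 :: real
  assumes \<sigma>: "\<bar>\<sigma>\<bar> = 1" and r: "0 < r" and y0: "\<bar>y0\<bar> < r"
    and avoid: "\<And>z. norm z = r \<Longrightarrow> 0 \<le> \<sigma> * Re z \<Longrightarrow> Im z \<noteq> y0 \<Longrightarrow> z \<notin> frontier E"
    and z: "norm z = r" "0 \<le> \<sigma> * Re z"
  shows "y0 < Im z \<Longrightarrow> z \<in> E \<longleftrightarrow> Complex 0 r \<in> E"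
    and "Im z < y0 \<Longrightarrow> z \<in> E \<longleftrightarrow> Complex 0 (- r) \<in> E"
proof -
  define c where "c y = Complex (\<sigma> * sqrt (r\<^sup>2 - y\<^sup>2)) y" for y
  have cont: "continuous_on S c" for S
    unfolding c_def Complex_eq by (intro continuous_intros)
  have c: "norm (c y) = r" "0 \<le> \<sigma> * Re (c y)" "Im (c y) = y" if "\<bar>y\<bar> \<le> r" for y
  proof -
    have "y\<^sup>2 \<le> r\<^sup>2" using that r abs_le_square_iff[of y r] by simp
    then show "norm (c y) = r" "0 \<le> \<sigma> * Re (c y)" "Im (c y) = y"
      using \<sigma> r by (auto simp: c_def norm_complex_def power_mult_distrib abs_if split: if_splits)
  qed
  have zc: "z = c (Im z)" "\<bar>Im z\<bar> \<le> r"
  proof -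
    show "\<bar>Im z\<bar> \<le> r" using abs_Im_le_cmod[of z] z by simp
    have "(Re z)\<^sup>2 = r\<^sup>2 - (Im z)\<^sup>2" using cmod_power2[of z] z(1) by simp
    then have "sqrt (r\<^sup>2 - (Im z)\<^sup>2) = \<bar>Re z\<bar>" by (metis real_sqrt_abs)
    then show "z = c (Im z)"
      using \<sigma> z by (auto simp: c_def complex_eq_iff abs_if split: if_splits)
  qed
  have ends: "c r = Complex 0 r" "c (- r) = Complex 0 (- r)" by (auto simp: c_def)
  have same: "c y \<in> E \<longleftrightarrow> c y' \<in> E" if S: "connected S" "S \<subseteq> {-r..r} - {y0}" and y: "y \<in> S" "y' \<in> S" for S y y'
  proof (rule connected_avoiding_frontier)
    show "connected (c ` S)" by (rule connected_continuous_image[OF cont S(1)])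
    show "c ` S \<inter> frontier E = {}"
      using S(2) avoid[OF c(1) c(2)] c(3) by (force simp: abs_le_iff)
  qed (use y in auto)
  show "z \<in> E \<longleftrightarrow> Complex 0 r \<in> E" if "y0 < Im z"
  proof -
    have "c (Im z) \<in> E \<longleftrightarrow> c r \<in> E"
      by (rule same[of "{y0<..r}"]) (use y0 zc(2) r that in auto)
    then show ?thesis unfolding ends zc(1)[symmetric] .
  qed
  show "z \<in> E \<longleftrightarrow> Complex 0 (- r) \<in> E" if "Im z < y0"
  proof -
    have "c (Im z) \<in> E \<longleftrightarrow> c (- r) \<in> E"
      by (rule same[of "{-r..<y0}"]) (use y0 zc(2) r that in auto)
    then show ?thesis unfolding ends zc(1)[symmetric] .
  qed
qed

locale graphlike_region = graphlike_curve +
  fixes \<Omega> :: "complex set"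
  assumes compact: "compact \<Omega>" and frontier: "frontier \<Omega> = range \<gamma>"
    and left: "\<forall>\<^sub>F \<epsilon> in at_right 0. \<gamma> s + \<epsilon> *\<^sub>R (\<i> * T s) \<in> interior \<Omega>"
begin

text \<open>
  The frame at \<open>s\<close> has origin \<open>\<gamma> s\<close> and first axis along the tangent; in its coordinates, \<open>region_at s\<close>
  is the region and \<open>chord s t\<close> is the point \<open>\<gamma> t\<close>.
\<close>

definition frame :: "real \<Rightarrow> complex \<Rightarrow> complex" where "frame s z = \<gamma> s + T s * z"
definition region_at :: "real \<Rightarrow> complex set" where "region_at s = {z. frame s z \<in> \<Omega>}"
definition chord :: "real \<Rightarrow> real \<Rightarrow> complex" where "chord s t = (\<gamma> t - \<gamma> s) / T s"

lemma frame_chord: "frame s (chord s t) = \<gamma> t"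
  using unit[of s] by (auto simp: frame_def chord_def)

lemma chord_of_frame:
  assumes "frame s z = \<gamma> t"
  shows "z = chord s t"
proof -
  have "\<gamma> t - \<gamma> s = T s * z" using assms by (metis add_diff_cancel_left' frame_def)
  moreover have "T s \<noteq> 0" using unit[of s] by force
  ultimately show ?thesis by (simp add: chord_def)
qed

lemma curve_in_region: "\<gamma> t \<in> \<Omega>"
  using frontier_subset_compact[OF compact] frontier by auto

lemma norm_chord: "norm (chord s t) = dist (\<gamma> s) (\<gamma> t)"
  using unit[of s] by (simp add: chord_def norm_divide dist_norm norm_minus_commute)

lemma Re_chord: "Re (chord s t) = (\<gamma> t - \<gamma> s) \<bullet> T s"
proof -
  have "(Re (T s))\<^sup>2 + (Im (T s))\<^sup>2 = 1" using unit[of s] by (simp add: norm_complex_def)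
  then show ?thesis by (simp add: chord_def Re_divide inner_complex_def)
qed

lemma isCont_frame: "isCont (frame s) z"
  unfolding frame_def by (intro continuous_intros)

lemma closed_region_at: "closed (region_at s)"
proof -
  have "region_at s = frame s -` \<Omega>" by (auto simp: region_at_def)
  then show ?thesis
    using compact isCont_frame by (simp add: closed_vimage compact_imp_closed continuous_at_imp_continuous_on)
qed

lemma frontier_region_at:
  assumes "z \<in> frontier (region_at s)"
  obtains t where "z = chord s t"
proof -
  have op: "open (frame s -` interior \<Omega>)"
    using isCont_frame by (simp add: open_vimage continuous_at_imp_continuous_on)
  have "frame s -` interior \<Omega> \<subseteq> region_at s" using interior_subset by (auto simp: region_at_def)
  then have "frame s -` interior \<Omega> \<subseteq> interior (region_at s)" using op by (rule interior_maximal)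
  moreover have "z \<in> region_at s" "z \<notin> interior (region_at s)"
    using assms closed_region_at[of s] by (auto simp: frontier_def closure_closed)
  ultimately have "frame s z \<in> frontier \<Omega>"
    using closure_subset[of \<Omega>] by (auto simp: frontier_def region_at_def)
  then obtain t where "frame s z = \<gamma> t" unfolding frontier by blast
  then show ?thesis using that chord_of_frame by blast
qed

lemma frontier_region_at_Re:
  assumes "z \<in> frontier (region_at s)" "z \<noteq> 0" "norm z \<le> R"
  shows "Re z \<noteq> 0"
proof -
  obtain t where t: "z = chord s t" using frontier_region_at[OF assms(1)] .
  have "dist (\<gamma> t) (\<gamma> s) \<le> R" "\<gamma> t \<noteq> \<gamma> s"
    using assms norm_chord[of s t] by (auto simp: t dist_commute chord_def)
  then have "(\<gamma> s - \<gamma> t) \<bullet> T s \<noteq> 0" using no_critical by blast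
  then show ?thesis by (simp add: t Re_chord inner_diff_left)
qed

abbreviation "zR s r \<equiv> chord s (exit s r)"
abbreviation "zL s r \<equiv> chord s (entry s r)"

lemma ends_props:
  assumes r: "0 < r" "r \<le> R"
  shows "norm (zR s r) = r" "0 < Re (zR s r)" "norm (zL s r) = r" "Re (zL s r) < 0"
    "\<bar>Im (zR s r)\<bar> < r" "\<bar>Im (zL s r)\<bar> < r"
proof -
  show n: "norm (zR s r) = r" "norm (zL s r) = r"
    using exit_props[of r s] entry_props[of r s] r by (auto simp: norm_chord)
  show p: "0 < Re (zR s r)" "Re (zL s r) < 0"
    unfolding Re_chord using r exit_gt[of r s] exit_mono_radius[of r R s] entry_less[of r s] entry_mono_radius[of r R s]
    by (auto intro!: forward_pos backward_neg)
  have "\<bar>Im z\<bar> < norm z" if "Re z \<noteq> 0" for z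
  proof -
    have "(Im z)\<^sup>2 < (norm z)\<^sup>2" using that by (simp add: cmod_power2)
    then show ?thesis using power2_less_imp_less[of "\<bar>Im z\<bar>" "norm z"] by simp
  qed
  from this[of "zR s r"] this[of "zL s r"] n p show "\<bar>Im (zR s r)\<bar> < r" "\<bar>Im (zL s r)\<bar> < r" by auto
qed

lemma frontier_on_circle:
  assumes r: "0 < r" "r \<le> R" and z: "z \<in> frontier (region_at s)" "norm z = r"
  shows "z = zR s r \<or> z = zL s r"
proof -
  obtain t where t: "z = chord s t" using frontier_region_at[OF z(1)] .
  then have "dist (\<gamma> s) (\<gamma> t) = r" using z norm_chord by simp
  from circle_meets_curve[OF r this] show ?thesis by (auto simp: t chord_def)
qed

text \<open>
  The normal line meets the curve in the disk at its foot point only, so each of its two halves is on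
  one side of the curve. The upper half starts inside by the orientation of the curve. For
  the lower half, the point at depth \<open>R\<close> serves as representative; \<open>below_outside\<close> decides its side.
\<close>

lemma vertical_axis:
  assumes r: "0 < r" "r \<le> R"
  shows "Complex 0 r \<in> region_at s" and "Complex 0 (- r) \<in> region_at s \<longleftrightarrow> Complex 0 (- R) \<in> region_at s"
proof -
  have axis: "Complex 0 (\<sigma> * y) \<in> region_at s \<longleftrightarrow> Complex 0 (\<sigma> * y') \<in> region_at s"
    if \<sigma>: "\<bar>\<sigma>\<bar> = 1" and y: "0 < y" "y \<le> R" "0 < y'" "y' \<le> R" for \<sigma> y y'
  proof (rule connected_avoiding_frontier)
    have "\<sigma> \<noteq> 0" using \<sigma> by auto
    have "Complex 0 (\<sigma> * y) \<notin> frontier (region_at s)" if "0 < y" "y \<le> R" for y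
      using frontier_region_at_Re[of "Complex 0 (\<sigma> * y)" s] that \<sigma> \<open>\<sigma> \<noteq> 0\<close>
      by (auto simp: complex_eq_iff norm_complex_def abs_mult)
    then show "(\<lambda>y. Complex 0 (\<sigma> * y)) ` {0<..R} \<inter> frontier (region_at s) = {}" by auto
    show "connected ((\<lambda>y. Complex 0 (\<sigma> * y)) ` {0<..R})"
      by (intro connected_continuous_image) (auto simp: Complex_eq intro!: continuous_intros)
  qed (use y in auto)
  have "\<forall>\<^sub>F \<epsilon> in at_right 0. \<epsilon> < R \<and> 0 < \<epsilon> \<and> \<gamma> s + \<epsilon> *\<^sub>R (\<i> * T s) \<in> interior \<Omega>"
    using left[of s] eventually_at_right_less[of "0::real"] R
    by (intro eventually_conj) (auto simp: eventually_at_right_field)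
  then obtain \<epsilon> where \<epsilon>: "0 < \<epsilon>" "\<epsilon> < R" "\<gamma> s + \<epsilon> *\<^sub>R (\<i> * T s) \<in> interior \<Omega>"
    using eventually_happens'[OF trivial_limit_at_right_real] by blast
  have "\<gamma> s + \<epsilon> *\<^sub>R (\<i> * T s) = frame s (Complex 0 \<epsilon>)"
    by (simp add: frame_def complex_eq_iff)
  then have "Complex 0 \<epsilon> \<in> region_at s"
    using \<epsilon>(3) interior_subset by (auto simp: region_at_def)
  then show "Complex 0 r \<in> region_at s" using axis[of 1 \<epsilon> r] \<epsilon> r by simp
  show "Complex 0 (- r) \<in> region_at s \<longleftrightarrow> Complex 0 (- R) \<in> region_at s"
    using axis[of "-1" r R] r R by simp
qed

lemma circle_sides:
  assumes r: "0 < r" "r \<le> R" and z: "norm z = r"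
  shows "0 \<le> Re z \<Longrightarrow> Im (zR s r) < Im z \<Longrightarrow> z \<in> region_at s"
    and "Re z \<le> 0 \<Longrightarrow> Im (zL s r) < Im z \<Longrightarrow> z \<in> region_at s"
    and "0 \<le> Re z \<Longrightarrow> Im z < Im (zR s r) \<Longrightarrow> z \<in> region_at s \<longleftrightarrow> Complex 0 (- R) \<in> region_at s"
    and "Re z \<le> 0 \<Longrightarrow> Im z < Im (zL s r) \<Longrightarrow> z \<in> region_at s \<longleftrightarrow> Complex 0 (- R) \<in> region_at s"
proof -
  note e = ends_props[OF r, of s]
  have right: "w \<notin> frontier (region_at s)" if "norm w = r" "0 \<le> 1 * Re w" "Im w \<noteq> Im (zR s r)" for w
  proof
    assume "w \<in> frontier (region_at s)"
    then have "w = zR s r \<or> w = zL s r" using frontier_on_circle[OF r _ that(1)] by blast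
    then show False using that(2,3) e(4) by (elim disjE) auto
  qed
  have left: "w \<notin> frontier (region_at s)" if "norm w = r" "0 \<le> - 1 * Re w" "Im w \<noteq> Im (zL s r)" for w
  proof
    assume "w \<in> frontier (region_at s)"
    then have "w = zR s r \<or> w = zL s r" using frontier_on_circle[OF r _ that(1)] by blast
    then show False using that(2,3) e(2) by (elim disjE) auto
  qed
  show "z \<in> region_at s" if "0 \<le> Re z" "Im (zR s r) < Im z"
    using half_circle_sides(1)[of "1", OF _ r(1) e(5) right z _ that(2)] that(1) vertical_axis(1)[OF r, of s] by simp
  show "z \<in> region_at s" if "Re z \<le> 0" "Im (zL s r) < Im z"
    using half_circle_sides(1)[of "-1", OF _ r(1) e(6) left z _ that(2)] that(1) vertical_axis(1)[OF r, of s] by simp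
  show "z \<in> region_at s \<longleftrightarrow> Complex 0 (- R) \<in> region_at s" if "0 \<le> Re z" "Im z < Im (zR s r)"
    using half_circle_sides(2)[of "1", OF _ r(1) e(5) right z _ that(2)] that(1) vertical_axis(2)[OF r, of s] by simp
  show "z \<in> region_at s \<longleftrightarrow> Complex 0 (- R) \<in> region_at s" if "Re z \<le> 0" "Im z < Im (zL s r)"
    using half_circle_sides(2)[of "-1", OF _ r(1) e(6) left z _ that(2)] that(1) vertical_axis(2)[OF r, of s] by simp
qed

text \<open>
  If the lower normal were inside as well, then so would be every circle of radius at most \<open>R\<close> around
  \<open>\<gamma> s\<close>, which would make \<open>\<gamma> s\<close> an interior point although it is on the frontier.
\<close>

lemma below_outside: "Complex 0 (- R) \<notin> region_at s"
proof
  assume below: "Complex 0 (- R) \<in> region_at s"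
  have "z \<in> region_at s" if z: "norm z \<le> R" for z
  proof (cases "z = 0")
    case True
    then show ?thesis by (simp add: region_at_def frame_def curve_in_region)
  next
    case False
    then have r: "0 < norm z" "norm z \<le> R" using z by auto
    have fr: "zR s (norm z) \<in> region_at s" "zL s (norm z) \<in> region_at s"
      by (simp_all add: region_at_def frame_chord curve_in_region)
    have eq: "z = w" if "norm z = norm w" "Im z = Im w" "0 \<le> Re z * Re w" for w
    proof -
      have "(Re z)\<^sup>2 = (Re w)\<^sup>2" using that(1,2) cmod_power2[of z] cmod_power2[of w] by simp
      then have "Re z = Re w \<or> Re z = - Re w" by (simp add: power2_eq_iff)
      moreover have "Re w = 0" if "Re z = - Re w"
        using \<open>0 \<le> Re z * Re w\<close> that by (auto simp: mult_le_0_iff)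
      ultimately show ?thesis using that(2) by (auto simp: complex_eq_iff)
    qed
    consider "0 \<le> Re z" "Im z = Im (zR s (norm z))" | "Re z \<le> 0" "Im z = Im (zL s (norm z))"
      | "0 \<le> Re z" "Im z \<noteq> Im (zR s (norm z))" | "Re z \<le> 0" "Im z \<noteq> Im (zL s (norm z))"
      using linear[of 0 "Re z"] by blast
    then show ?thesis
    proof cases
      case 1
      have "z = zR s (norm z)"
        by (rule eq) (use 1 ends_props(1,2)[OF r, of s] in simp_all)
      then show ?thesis using fr(1) by (rule ssubst)
    next
      case 2
      have "z = zL s (norm z)"
        by (rule eq) (use 2 ends_props(3,4)[OF r, of s] in \<open>simp_all add: mult_nonpos_nonpos\<close>)
      then show ?thesis using fr(2) by (rule ssubst)
    next
      case 3
      then consider "Im (zR s (norm z)) < Im z" | "Im z < Im (zR s (norm z))" by linarith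
      then show ?thesis using circle_sides(1,3)[OF r refl, of s] 3(1) below by cases blast+
    next
      case 4
      then consider "Im (zL s (norm z)) < Im z" | "Im z < Im (zL s (norm z))" by linarith
      then show ?thesis using circle_sides(2,4)[OF r refl, of s] 4(1) below by cases blast+
    qed
  qed
  then have "ball (\<gamma> s) R \<subseteq> \<Omega>"
  proof (intro subsetI)
    fix w assume w: "w \<in> ball (\<gamma> s) R"
    assume all: "\<And>z. norm z \<le> R \<Longrightarrow> z \<in> region_at s"
    have "norm ((w - \<gamma> s) / T s) \<le> R" using w unit[of s] by (simp add: norm_divide dist_norm norm_minus_commute)
    then have "frame s ((w - \<gamma> s) / T s) \<in> \<Omega>" using all by (simp add: region_at_def)
    moreover have "frame s ((w - \<gamma> s) / T s) = w" using unit[of s] by (auto simp: frame_def)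
    ultimately show "w \<in> \<Omega>" by simp
  qed
  then have "\<gamma> s \<in> interior \<Omega>" using R by (meson centre_in_ball interior_maximal open_ball subsetD)
  moreover have "\<gamma> s \<in> frontier \<Omega>" using frontier by simp
  ultimately show False by (simp add: frontier_def)
qed

lemma circle_arc_region:
  assumes r: "0 < r" "r \<le> R"
  shows "circle_arc (region_at s) r (Im (zR s r)) (Im (zL s r))"
proof
  show "region_at s \<in> sets borel" using closed_region_at by simp
  show "finite (frontier (region_at s) \<inter> sphere 0 r)"
  proof (rule finite_subset)
    show "frontier (region_at s) \<inter> sphere 0 r \<subseteq> {zR s r, zL s r}"
    proof
      fix w assume "w \<in> frontier (region_at s) \<inter> sphere 0 r"
      then show "w \<in> {zR s r, zL s r}" using frontier_on_circle[OF r, of w s] by simp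
    qed
  qed simp
  show "\<bar>Im (zR s r)\<bar> < r" "\<bar>Im (zL s r)\<bar> < r" by (rule ends_props[OF r])+
  show "z \<in> region_at s \<longleftrightarrow> Im (zR s r) < Im z" if "norm z = r" "0 < Re z" "Im z \<noteq> Im (zR s r)" for z
    using circle_sides[OF r that(1), of s] that below_outside[of s] by force
  show "z \<in> region_at s \<longleftrightarrow> Im (zL s r) < Im z" if "norm z = r" "Re z < 0" "Im z \<noteq> Im (zL s r)" for z
    using circle_sides[OF r that(1), of s] that below_outside[of s] by force
qed (rule r)

end

section \<open>The derivatives of the area invariant\<close>

text \<open>
  A disk whose centre is moved by \<open>\<delta>\<close> stays inside the concentric disk of radius \<open>r + \<delta>\<close>, and the
  annulus between the two has area \<open>pi * (2 * r + \<delta>) * \<delta>\<close>.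
\<close>

lemma area_in_disk_Lipschitz:
  fixes \<Omega> :: "complex set"
  assumes \<Omega>[measurable]: "\<Omega> \<in> sets borel" and r: "0 < r" and pq: "dist p q \<le> 1"
  shows "\<bar>measure lebesgue (\<Omega> \<inter> cball p r) - measure lebesgue (\<Omega> \<inter> cball q r)\<bar> \<le> pi * (2 * r + 1) * dist p q"
proof -
  let ?\<delta> = "dist p q"
  have fin: "emeasure lborel (S \<inter> cball c \<rho>) < \<infinity>" for S c and \<rho> :: real
    using emeasure_bounded_finite[of "S \<inter> cball c \<rho>"] bounded_subset[OF bounded_cball, of "S \<inter> cball c \<rho>" c \<rho>] by (auto simp: less_top)
  have disk: "measure lborel (cball a \<rho>) = pi * \<rho>\<^sup>2" if "0 \<le> \<rho>" for a :: complex and \<rho>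
    using content_cball[OF that, of a] by (simp only: DIM_complex of_nat_numeral unit_ball_vol_2)
  have step: "measure lborel (\<Omega> \<inter> cball b r) \<le> measure lborel (\<Omega> \<inter> cball a r) + pi * (2 * r + 1) * ?\<delta>"
    if ab: "dist a b = ?\<delta>" for a b :: complex
  proof -
    have sub: "\<Omega> \<inter> cball b r \<subseteq> (\<Omega> \<inter> cball a r) \<union> (cball a (r + ?\<delta>) - cball a r)"
    proof
      fix z assume z: "z \<in> \<Omega> \<inter> cball b r"
      then have "dist a z \<le> r + ?\<delta>" using ab dist_triangle[of a z b] by auto
      then show "z \<in> (\<Omega> \<inter> cball a r) \<union> (cball a (r + ?\<delta>) - cball a r)" using z by auto
    qed
    have f: "\<Omega> \<inter> cball a r \<in> fmeasurable lborel" "cball a (r + ?\<delta>) - cball a r \<in> fmeasurable lborel"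
        "cball a (r + ?\<delta>) \<in> fmeasurable lborel" "cball a r \<in> fmeasurable lborel"
      using fin[of \<Omega> a r] fin[of UNIV a "r + ?\<delta>"] fin[of UNIV a r] 
      by (auto intro!: fmeasurableI fmeasurable.Diff)
    have "measure lborel (\<Omega> \<inter> cball b r) \<le> measure lborel ((\<Omega> \<inter> cball a r) \<union> (cball a (r + ?\<delta>) - cball a r))"
      by (rule measure_mono_fmeasurable[OF sub]) (use f in auto)
    also have "\<dots> \<le> measure lborel (\<Omega> \<inter> cball a r) + measure lborel (cball a (r + ?\<delta>) - cball a r)"
      by (rule measure_Un_le) auto
    also have "measure lborel (cball a (r + ?\<delta>) - cball a r) = measure lborel (cball a (r + ?\<delta>)) - measure lborel (cball a r)"
      using f subset_cball[of r "r + ?\<delta>" a] by (intro measurable_measure_Diff) auto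
    also have "\<dots> = pi * (r + ?\<delta>)\<^sup>2 - pi * r\<^sup>2"
      using r by (simp only: disk add_nonneg_nonneg[OF less_imp_le zero_le_dist] less_imp_le)
    also have "\<dots> = pi * ((2 * r + ?\<delta>) * ?\<delta>)" by (simp add: algebra_simps power2_eq_square)
    also have "\<dots> \<le> pi * ((2 * r + 1) * ?\<delta>)" using pq by (intro mult_left_mono mult_right_mono) auto
    finally show ?thesis by (simp add: mult.assoc)
  qed
  have "measure lebesgue (\<Omega> \<inter> cball c r) = measure lborel (\<Omega> \<inter> cball c r)" for c by simp
  then show ?thesis using step[of p q] step[of q p] by (simp add: dist_commute abs_le_iff)
qed

text \<open>
  By the Lipschitz bound, replacing the curve by its tangent line changes the argument by \<open>o(h)\<close>
  and hence does not change the derivative.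
\<close>

lemma has_real_derivative_along_tangent:
  fixes f :: "real \<Rightarrow> complex" and A :: "complex \<Rightarrow> real"
  assumes f: "(f has_vector_derivative v) (at s)"
    and Lip: "\<And>p q. dist p q \<le> 1 \<Longrightarrow> \<bar>A p - A q\<bar> \<le> K * dist p q"
    and A: "((\<lambda>h. A (f s + h *\<^sub>R v)) has_real_derivative D) (at 0)"
  shows "((\<lambda>t. A (f t)) has_real_derivative D) (at s)"
proof -
  define \<delta> where "\<delta> h = norm (f (s + h) - f s - h *\<^sub>R v)" for h
  have small: "((\<lambda>h. \<delta> h / norm h) \<longlongrightarrow> 0) (at 0)"
    using f unfolding has_vector_derivative_def has_derivative_at \<delta>_def by blast
  have "((\<lambda>h. \<delta> h / norm h * norm h) \<longlongrightarrow> 0) (at 0)"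
    using tendsto_mult[OF small tendsto_norm_zero[OF tendsto_ident_at]] by (simp only: mult_zero_right)
  moreover have "\<forall>\<^sub>F h in at 0. \<delta> h / norm h * norm h = \<delta> h"
    unfolding eventually_at_filter by simp
  ultimately have "(\<delta> \<longlongrightarrow> 0) (at 0)" by (rule Lim_transform_eventually)
  then have ev: "\<forall>\<^sub>F h in at 0. \<delta> h < 1" by (rule order_tendstoD) simp
  have "((\<lambda>h. (A (f (s + h)) - A (f s + h *\<^sub>R v)) / h) \<longlongrightarrow> 0) (at 0)"
  proof (rule Lim_null_comparison)
    show "\<forall>\<^sub>F h in at 0. norm ((A (f (s + h)) - A (f s + h *\<^sub>R v)) / h) \<le> K * (\<delta> h / norm h)"
      using ev
    proof eventually_elim
      case (elim h)
      have d: "dist (f (s + h)) (f s + h *\<^sub>R v) = \<delta> h" by (simp add: \<delta>_def dist_norm algebra_simps)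
      have "\<bar>A (f (s + h)) - A (f s + h *\<^sub>R v)\<bar> \<le> K * \<delta> h"
        using Lip[of "f (s + h)" "f s + h *\<^sub>R v"] elim by (simp add: d)
      then have "\<bar>A (f (s + h)) - A (f s + h *\<^sub>R v)\<bar> / \<bar>h\<bar> \<le> K * \<delta> h / \<bar>h\<bar>"
        by (rule divide_right_mono) simp
      then show ?case by simp
    qed
    show "((\<lambda>h. K * (\<delta> h / norm h)) \<longlongrightarrow> 0) (at 0)"
      using tendsto_mult[OF tendsto_const[of K] small] by simp
  qed
  moreover have "((\<lambda>h. (A (f s + h *\<^sub>R v) - A (f s)) / h) \<longlongrightarrow> D) (at 0)"
    using A by (simp add: DERIV_def)
  ultimately have "((\<lambda>h. (A (f (s + h)) - A (f s + h *\<^sub>R v)) / h + (A (f s + h *\<^sub>R v) - A (f s)) / h) \<longlongrightarrow> 0 + D) (at 0)"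
    by (rule tendsto_add)
  then show ?thesis by (simp add: DERIV_def add_divide_distrib[symmetric])
qed

context graphlike_region
begin

lemma area_in_frame:
  "measure lebesgue (\<Omega> \<inter> cball (frame s c) r) = measure lborel (region_at s \<inter> cball c r)"
proof -
  have b: "\<Omega> \<in> sets borel" using compact by (simp add: borel_compact)
  have "dist (frame s c) (frame s z) = dist c z" for z
  proof -
    have "frame s c - frame s z = T s * (c - z)" by (simp add: frame_def algebra_simps)
    then show ?thesis by (simp add: dist_norm norm_mult unit)
  qed
  then have e: "{z. \<gamma> s + T s * z \<in> \<Omega> \<inter> cball (frame s c) r} = region_at s \<inter> cball c r"
    by (auto simp: region_at_def frame_def)
  have "measure lebesgue (\<Omega> \<inter> cball (frame s c) r) = measure lborel (\<Omega> \<inter> cball (frame s c) r)"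
    using b by simp
  also have "\<dots> = measure lborel {z. \<gamma> s + T s * z \<in> \<Omega> \<inter> cball (frame s c) r}"
    using b unit[of s] by (intro measure_rigid_image[symmetric]) auto
  finally show ?thesis by (simp only: e)
qed

lemma area_invariant_derivative_position:
  assumes r: "0 < r" "r \<le> R"
  shows "((\<lambda>t. measure lebesgue (\<Omega> \<inter> cball (\<gamma> t) r)) has_real_derivative (Im (zL s r) - Im (zR s r))) (at s)"
proof (rule has_real_derivative_along_tangent[OF deriv])
  show "\<bar>measure lebesgue (\<Omega> \<inter> cball p r) - measure lebesgue (\<Omega> \<inter> cball q r)\<bar> \<le> pi * (2 * r + 1) * dist p q"
    if "dist p q \<le> 1" for p q
    using compact r that by (intro area_in_disk_Lipschitz) (auto simp: borel_compact)
  have "\<gamma> s + h *\<^sub>R T s = frame s (of_real h)" for h by (simp add: frame_def scaleR_conv_of_real)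
  then show "((\<lambda>h. measure lebesgue (\<Omega> \<inter> cball (\<gamma> s + h *\<^sub>R T s) r)) has_real_derivative (Im (zL s r) - Im (zR s r))) (at 0)"
    using circle_arc.translation_derivative[OF circle_arc_region[OF r, of s]] by (simp add: area_in_frame)
qed

lemma area_invariant_derivative_radius:
  assumes r: "0 < r" "r \<le> R"
  shows "((\<lambda>r. measure lebesgue (\<Omega> \<inter> cball (\<gamma> s) r)) has_real_derivative
     r * (pi - arcsin (Im (zR s r) / r) - arcsin (Im (zL s r) / r))) (at r)"
proof -
  have "\<gamma> s = frame s 0" by (simp add: frame_def)
  then show ?thesis
    using circle_arc.radius_derivative[OF circle_arc_region[OF r, of s]] by (simp only: area_in_frame)
qed

end

text \<open>
  The exit chord is expressed in the frame of the curve, and in this frame its end point is on the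
  right half circle of radius \<open>r\<close>; so its height determines it, and the height is determined by the
  two derivatives of the area.
\<close>

theorem area_data_determine_exit_chord:
  assumes "graphlike_region L1 \<gamma>1 T1 R \<Omega>1" "graphlike_region L2 \<gamma>2 T2 R \<Omega>2" and r: "0 < r" "r \<le> R"
    and ds: "((\<lambda>t. measure lebesgue (\<Omega>1 \<inter> cball (\<gamma>1 t) r)) has_real_derivative Ds) (at s)"
      "((\<lambda>t. measure lebesgue (\<Omega>2 \<inter> cball (\<gamma>2 t) r)) has_real_derivative Ds) (at s)"
    and dr: "((\<lambda>r. measure lebesgue (\<Omega>1 \<inter> cball (\<gamma>1 s) r)) has_real_derivative Dr) (at r)"
      "((\<lambda>r. measure lebesgue (\<Omega>2 \<inter> cball (\<gamma>2 s) r)) has_real_derivative Dr) (at r)"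
  shows "(\<gamma>1 (exit_time \<gamma>1 s r) - \<gamma>1 s) / T1 s = (\<gamma>2 (exit_time \<gamma>2 s r) - \<gamma>2 s) / T2 s"
proof -
  interpret c1: graphlike_region L1 \<gamma>1 T1 R \<Omega>1 by fact
  interpret c2: graphlike_region L2 \<gamma>2 T2 R \<Omega>2 by fact
  note e1 = c1.ends_props[OF r, of s] and e2 = c2.ends_props[OF r, of s]
  have "Im (c1.zL s r) - Im (c1.zR s r) = Im (c2.zL s r) - Im (c2.zR s r)"
    using DERIV_unique[OF ds(1) c1.area_invariant_derivative_position[OF r]]
      DERIV_unique[OF ds(2) c2.area_invariant_derivative_position[OF r]] by simp
  moreover have "r * (pi - arcsin (Im (c1.zR s r) / r) - arcsin (Im (c1.zL s r) / r))
      = r * (pi - arcsin (Im (c2.zR s r) / r) - arcsin (Im (c2.zL s r) / r))"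
    by (rule trans[OF DERIV_unique[OF c1.area_invariant_derivative_radius[OF r] dr(1)]
        DERIV_unique[OF dr(2) c2.area_invariant_derivative_radius[OF r]]])
  ultimately have im: "Im (c1.zR s r) = Im (c2.zR s r)"
    by (rule arc_data_determine_right_end[OF e1(5,6) e2(5,6)])
  have "(Re (c1.zR s r))\<^sup>2 = (Re (c2.zR s r))\<^sup>2"
    using cmod_power2[of "c1.zR s r"] cmod_power2[of "c2.zR s r"] e1(1) e2(1) im by simp
  then have "Re (c1.zR s r) = Re (c2.zR s r)"
    using e1(2) e2(2) by (simp add: power2_eq_iff_nonneg)
  with im have "c1.zR s r = c2.zR s r" by (simp add: complex_eq_iff)
  then show ?thesis by (simp only: c1.chord_def c2.chord_def)
qed

section \<open>Reconstruction of a curve from its exit chords\<close>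

text \<open>
  Two monotone parametrizations of one trace by unit-speed curves advance by the same length. The
  differentiability of \<open>u1\<close> and \<open>u2\<close> is replaced by comparing arcs with chords on a fine partition;
  the other inequality holds by symmetry.
\<close>

lemma unit_speed_reparametrization_rigid:
  fixes a b :: real
  assumes "closed_curve L1 \<gamma>1 T1" "closed_curve L2 \<gamma>2 T2" and ab: "a \<le> b"
    and u1: "continuous_on {a..b} u1" "mono_on {a..b} u1" and u2: "mono_on {a..b} u2"
    and eq: "\<And>x. x \<in> {a..b} \<Longrightarrow> \<gamma>1 (u1 x) = \<gamma>2 (u2 x)"
  shows "u1 b - u1 a \<le> u2 b - u2 a"
proof -
  interpret c1: closed_curve L1 \<gamma>1 T1 by fact
  interpret c2: closed_curve L2 \<gamma>2 T2 by fact
  have main: "(1 - \<epsilon>) * (u1 b - u1 a) \<le> u2 b - u2 a" if \<epsilon>: "0 < \<epsilon>" for \<epsilon>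
  proof -
    obtain \<delta> where \<delta>: "0 < \<delta>" "\<And>x y. x \<in> {u1 a..u1 b} \<Longrightarrow> y \<in> {u1 a..u1 b} \<Longrightarrow> \<bar>x - y\<bar> < \<delta>
        \<Longrightarrow> (1 - \<epsilon>) * \<bar>x - y\<bar> \<le> dist (\<gamma>1 x) (\<gamma>1 y)"
      using c1.local_near_isometry[OF \<epsilon>, of "u1 a" "u1 b"] by blast
    have "uniformly_continuous_on {a..b} u1" by (intro compact_uniformly_continuous u1) auto
    then obtain \<eta> where \<eta>: "0 < \<eta>" "\<And>x y. x \<in> {a..b} \<Longrightarrow> y \<in> {a..b} \<Longrightarrow> dist x y < \<eta> \<Longrightarrow> dist (u1 x) (u1 y) < \<delta>"
      using \<delta>(1) unfolding uniformly_continuous_on_def by (metis dist_commute)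
    \<comment> \<open>The partition is so fine that \<open>u1\<close> moves by less than \<open>\<delta>\<close> in each step.\<close>
    define n where "n = nat \<lceil>(b - a) / \<eta>\<rceil> + 1"
    define p where "p i = a + real i * (b - a) / real n" for i
    have n: "0 < n" "(b - a) / real n < \<eta>"
    proof -
      show n0: "0 < n" by (simp add: n_def)
      have "(b - a) / \<eta> < real n" unfolding n_def by linarith
      then show "(b - a) / real n < \<eta>" using \<eta>(1) n0 by (simp add: field_simps)
    qed
    have p_in: "p i \<in> {a..b}" if "i \<le> n" for i
    proof -
      have "real i * (b - a) / real n \<le> real n * (b - a) / real n"
        using that ab by (intro divide_right_mono mult_right_mono) auto
      then show ?thesis using ab n by (auto simp: p_def)
    qed
    have p_step: "p (Suc i) = p i + (b - a) / real n" for i by (simp add: p_def add_divide_distrib distrib_right)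
    have step: "(1 - \<epsilon>) * (u1 (p (Suc i)) - u1 (p i)) \<le> u2 (p (Suc i)) - u2 (p i)" if i: "i < n" for i
    proof -
      have m: "p i \<in> {a..b}" "p (Suc i) \<in> {a..b}" "p i \<le> p (Suc i)"
        using p_in[of i] p_in[of "Suc i"] i ab p_step[of i] by auto
      have inc: "u1 (p i) \<le> u1 (p (Suc i))" "u2 (p i) \<le> u2 (p (Suc i))"
        using m u1(2) u2 by (auto simp: mono_on_def)
      have rng: "u1 x \<in> {u1 a..u1 b}" if "x \<in> {a..b}" for x
        using that u1(2) by (auto simp: mono_on_def)
      have "dist (p (Suc i)) (p i) < \<eta>" using n ab p_step[of i] by (simp add: dist_real_def)
      then have "\<bar>u1 (p (Suc i)) - u1 (p i)\<bar> < \<delta>" using \<eta>(2)[OF m(2,1)] by (simp add: dist_real_def)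
      then have "(1 - \<epsilon>) * \<bar>u1 (p (Suc i)) - u1 (p i)\<bar> \<le> dist (\<gamma>1 (u1 (p (Suc i)))) (\<gamma>1 (u1 (p i)))"
        by (intro \<delta>(2) rng m)
      also have "\<dots> = dist (\<gamma>2 (u2 (p (Suc i)))) (\<gamma>2 (u2 (p i)))" using eq m by simp
      also have "\<dots> \<le> \<bar>u2 (p (Suc i)) - u2 (p i)\<bar>" by (rule c2.dist_le)
      finally show ?thesis using inc by simp
    qed
    have "(1 - \<epsilon>) * (u1 (p k) - u1 (p 0)) \<le> u2 (p k) - u2 (p 0)" if "k \<le> n" for k
      using that
    proof (induction k)
      case (Suc k)
      then show ?case using step[of k] by (simp add: algebra_simps)
    qed simp
    from this[of n] show ?thesis using n by (simp add: p_def)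
  qed
  have "((\<lambda>\<epsilon>. (1 - \<epsilon>) * (u1 b - u1 a)) \<longlongrightarrow> (1 - 0) * (u1 b - u1 a)) (at_right 0)"
    by (intro tendsto_intros)
  then have "(1 - 0) * (u1 b - u1 a) \<le> u2 b - u2 a"
    by (rule tendsto_upperbound) (auto intro!: eventually_mono[OF eventually_at_right_less] main)
  then show ?thesis by simp
qed

lemma vector_derivative_agree_within:
  fixes f g :: "real \<Rightarrow> complex"
  assumes ab: "a < b" and eq: "\<And>x. x \<in> {a..b} \<Longrightarrow> f x = g x" and s: "s \<in> {a..b}"
    and f: "(f has_vector_derivative f') (at s)" and g: "(g has_vector_derivative g') (at s)"
  shows "f' = g'"
proof (rule vector_derivative_unique_within)
  show "at s within {a..b} \<noteq> bot"
    using ab s by (simp add: trivial_limit_within islimpt_Icc)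
  show "(f has_vector_derivative f') (at s within {a..b})" using f by (rule has_vector_derivative_at_within)
  have "(g has_vector_derivative g') (at s within {a..b})" using g by (rule has_vector_derivative_at_within)
  then show "(f has_vector_derivative g') (at s within {a..b})"
    by (rule has_vector_derivative_transform[rotated 2]) (use s eq in auto)
qed

text \<open>
  On the first arc the curves agree, since the exit points for all radii up to \<open>R\<close> trace the same
  set in the same order, and rigidity makes the parameters agree. If the curves agree up to \<open>b\<close>, then
  so do the tangents, hence the exit points for radius \<open>R\<close> of all \<open>s \<le> b\<close>; as \<open>s\<close> runs up to \<open>b\<close> these
  trace the curves beyond \<open>b\<close> by a length of at least \<open>R\<close>, and rigidity applies again.
\<close>

theorem exit_chords_determine_curve:
  assumes "graphlike_curve L1 \<gamma>1 T1 R" "graphlike_curve L2 \<gamma>2 T2 R"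
    and start: "\<gamma>1 \<sigma> = \<gamma>2 \<sigma>" "T1 \<sigma> = T2 \<sigma>"
    and chord: "\<And>s. \<sigma> \<le> s \<Longrightarrow> (\<gamma>1 (exit_time \<gamma>1 s R) - \<gamma>1 s) / T1 s = (\<gamma>2 (exit_time \<gamma>2 s R) - \<gamma>2 s) / T2 s"
    and chord0: "\<And>r. 0 < r \<Longrightarrow> r \<le> R \<Longrightarrow> (\<gamma>1 (exit_time \<gamma>1 \<sigma> r) - \<gamma>1 \<sigma>) / T1 \<sigma> = (\<gamma>2 (exit_time \<gamma>2 \<sigma> r) - \<gamma>2 \<sigma>) / T2 \<sigma>"
    and t: "\<sigma> \<le> t"
  shows "\<gamma>1 t = \<gamma>2 t"
proof -
  interpret c1: graphlike_curve L1 \<gamma>1 T1 R by fact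
  interpret c2: graphlike_curve L2 \<gamma>2 T2 R by fact
  have R: "0 < R" by (rule c1.R)
  have rigid: "u1 x - u1 a = u2 x - u2 a"
    if "x \<in> {a..b}" "continuous_on {a..b} u1" "mono_on {a..b} u1" "continuous_on {a..b} u2" "mono_on {a..b} u2"
      "\<And>x. x \<in> {a..b} \<Longrightarrow> \<gamma>1 (u1 x) = \<gamma>2 (u2 x)" for a b x :: real and u1 u2 :: "real \<Rightarrow> real"
  proof -
    have sub: "{a..x} \<subseteq> {a..b}" using that(1) by auto
    have "u1 x - u1 a \<le> u2 x - u2 a"
      by (rule unit_speed_reparametrization_rigid[OF c1.closed_curve_axioms c2.closed_curve_axioms])
        (use that sub in \<open>auto intro: continuous_on_subset mono_on_subset\<close>)
    moreover have "u2 x - u2 a \<le> u1 x - u1 a"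
      by (rule unit_speed_reparametrization_rigid[OF c2.closed_curve_axioms c1.closed_curve_axioms])
        (use that sub in \<open>auto intro: continuous_on_subset mono_on_subset\<close>)
    ultimately show ?thesis by simp
  qed
  have same_exit: "\<gamma>1 (c1.exit s r) = \<gamma>2 (c2.exit s r)"
    if "\<gamma>1 s = \<gamma>2 s" "T1 s = T2 s" "(\<gamma>1 (c1.exit s r) - \<gamma>1 s) / T1 s = (\<gamma>2 (c2.exit s r) - \<gamma>2 s) / T2 s" for s r
    using that c1.unit[of s] by auto
  have e0: "c1.exit \<sigma> 0 = \<sigma>" "c2.exit \<sigma> 0 = \<sigma>"
    using c1.exit_props(1)[of 0 \<sigma>] c1.exit_props(4)[of 0 \<sigma> \<sigma>] c2.exit_props(1)[of 0 \<sigma>] c2.exit_props(4)[of 0 \<sigma> \<sigma>] R by auto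
  have first_exit: "c1.exit \<sigma> r = c2.exit \<sigma> r" if r: "r \<in> {0..R}" for r
  proof -
    have "c1.exit \<sigma> r - c1.exit \<sigma> 0 = c2.exit \<sigma> r - c2.exit \<sigma> 0"
    proof (rule rigid[OF r c1.exit_continuous_radius _ c2.exit_continuous_radius])
      show "mono_on {0..R} (c1.exit \<sigma>)" "mono_on {0..R} (c2.exit \<sigma>)"
        by (auto intro!: mono_onI c1.exit_mono_radius c2.exit_mono_radius)
      show "\<gamma>1 (c1.exit \<sigma> r) = \<gamma>2 (c2.exit \<sigma> r)" if "r \<in> {0..R}" for r
        using that same_exit[OF start chord0[of r]] start e0 by (cases "r = 0") auto
    qed
    then show ?thesis using e0 by simp
  qed
  define e where "e = c1.exit \<sigma> R"
  have e: "\<sigma> < e" using c1.exit_gt[of R \<sigma>] R by (simp add: e_def)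
  have base: "\<gamma>1 x = \<gamma>2 x" if x: "x \<in> {\<sigma>..e}" for x
  proof -
    define r where "r = dist (\<gamma>1 \<sigma>) (\<gamma>1 x)"
    have r: "r \<in> {0..R}" "c1.exit \<sigma> r = x"
      using c1.forward_dist_le[of \<sigma> x] c1.exit_of_dist[of \<sigma> x] x by (auto simp: r_def e_def)
    then show ?thesis
      using first_exit[of r] same_exit[OF start chord0[of r]] start e0 by (cases "r = 0") auto
  qed
  \<comment> \<open>The exit from the disk around the last common point is at least \<open>R\<close> further along the curve.\<close>
  have extend: "\<forall>x\<in>{\<sigma>..b + R}. \<gamma>1 x = \<gamma>2 x" if b: "e \<le> b" and agree: "\<forall>x\<in>{\<sigma>..b}. \<gamma>1 x = \<gamma>2 x" for b
  proof -
    have sb: "\<sigma> < b" using e b by simp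
    have tangent: "T1 s = T2 s" if "s \<in> {\<sigma>..b}" for s
      using agree that by (intro vector_derivative_agree_within[OF sb _ that c1.deriv c2.deriv]) auto
    have hit: "\<gamma>1 (c1.exit s R) = \<gamma>2 (c2.exit s R)" if "s \<in> {\<sigma>..b}" for s
      using agree that tangent[OF that] chord[of s] by (intro same_exit) auto
    have exits: "c1.exit s R = c2.exit s R" if s: "s \<in> {\<sigma>..b}" for s
    proof -
      have "c1.exit s R - c1.exit \<sigma> R = c2.exit s R - c2.exit \<sigma> R"
        by (rule rigid[OF s, of "\<lambda>s. c1.exit s R" "\<lambda>s. c2.exit s R"])
          (auto intro!: mono_onI c1.exit_mono c2.exit_mono hit continuous_at_imp_continuous_on c1.isCont_exit c2.isCont_exit)
      then show ?thesis using first_exit[of R] R by simp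
    qed
    show ?thesis
    proof
      fix x assume x: "x \<in> {\<sigma>..b + R}"
      show "\<gamma>1 x = \<gamma>2 x"
      proof (cases "x \<le> e")
        case True
        then show ?thesis using base x by simp
      next
        case False
        have "R \<le> c1.exit b R - b"
          using c1.dist_le[of b "c1.exit b R"] c1.exit_props[of R b] R by simp
        then have "x \<le> c1.exit b R" using x by simp
        then obtain s where "\<sigma> \<le> s" "s \<le> b" "c1.exit s R = x"
          using IVT[of "\<lambda>s. c1.exit s R" \<sigma> x b] False sb c1.isCont_exit by (auto simp: e_def)
        then show ?thesis using hit[of s] exits[of s] by auto
      qed
    qed
  qed
  have "\<forall>x\<in>{\<sigma>..e + real n * R}. \<gamma>1 x = \<gamma>2 x" for n
  proof (induction n)
    case 0
    then show ?case using base by simp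
  next
    case (Suc n)
    have "\<forall>x\<in>{\<sigma>..(e + real n * R) + R}. \<gamma>1 x = \<gamma>2 x"
      using Suc R by (intro extend) auto
    then show ?case by (simp add: algebra_simps)
  qed
  moreover obtain n :: nat where "t - e < real n * R" using R ex_less_of_nat_mult by blast
  then have "t \<in> {\<sigma>..e + real n * R}" using t by simp
  ultimately show ?thesis by blast
qed

section \<open>Periodic extension of the boundary parametrization\<close>

definition periodic_extension :: "real \<Rightarrow> (real \<Rightarrow> 'a) \<Rightarrow> real \<Rightarrow> 'a" where
  "periodic_extension L f t = f (t - of_int \<lfloor>t / L\<rfloor> * L)"

lemma period_remainder:
  fixes L t :: real
  assumes "0 < L"
  shows "t - of_int \<lfloor>t / L\<rfloor> * L \<in> {0..<L}"
proof -
  have "of_int \<lfloor>t / L\<rfloor> * L \<le> t" "t < (of_int \<lfloor>t / L\<rfloor> + 1) * L"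
    using floor_divide_lower[OF assms, of t] floor_divide_upper[OF assms, of t] by simp_all
  then show ?thesis by (simp add: distrib_right)
qed

lemma periodic_extension_eq:
  assumes "0 < L" "f 0 = f L" "t \<in> {of_int k * L..of_int k * L + L}"
  shows "periodic_extension L f t = f (t - of_int k * L)"
proof (cases "t = of_int k * L + L")
  case True
  then have "t / L = of_int (k + 1)" using assms(1) by (simp add: field_simps)
  then show ?thesis using True assms(2) by (simp add: periodic_extension_def algebra_simps)
next
  case False
  then have "of_int k \<le> t / L" "t / L < of_int k + 1"
    using assms by (simp_all add: pos_le_divide_eq pos_divide_less_eq distrib_right)
  then have "\<lfloor>t / L\<rfloor> = k" by (simp add: floor_eq_iff)
  then show ?thesis by (simp add: periodic_extension_def)
qed

lemma periodic_extension_on_period: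
  "0 < L \<Longrightarrow> f 0 = f L \<Longrightarrow> t \<in> {0..L} \<Longrightarrow> periodic_extension L f t = f t"
  using periodic_extension_eq[of L f t 0] by simp

lemma periodic_extension_periodic:
  assumes "0 < L"
  shows "periodic_extension L f (t + L) = periodic_extension L f t"
proof -
  have "\<lfloor>(t + L) / L\<rfloor> = \<lfloor>t / L\<rfloor> + 1" using assms by (simp add: add_divide_distrib)
  then show ?thesis by (simp add: periodic_extension_def algebra_simps)
qed

text \<open>
  Glues one-sided information at the multiples of \<open>L\<close>, where two period intervals meet.
\<close>

lemma tendsto_at_from_period_intervals:
  fixes F :: "real \<Rightarrow> 'a :: topological_space"
  assumes L: "0 < L" and lim: "\<And>k::int. t \<in> {of_int k * L..of_int k * L + L} \<Longrightarrow> (F \<longlongrightarrow> l) (at t within {of_int k * L..of_int k * L + L})"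
  shows "(F \<longlongrightarrow> l) (at t)"
proof -
  define k where "k = \<lfloor>t / L\<rfloor>"
  have k: "of_int k * L \<le> t" "t < of_int k * L + L" using period_remainder[OF L, of t] by (auto simp: k_def)
  show ?thesis
  proof (cases "t = of_int k * L")
    case False
    have "t \<in> interior {of_int k * L..of_int k * L + L}" using k False by (simp add: interior_atLeastAtMost_real)
    then have "at t within {of_int k * L..of_int k * L + L} = at t" by (rule at_within_interior)
    moreover have "(F \<longlongrightarrow> l) (at t within {of_int k * L..of_int k * L + L})" using k by (intro lim) auto
    ultimately show ?thesis by simp
  next
    case True
    have A: "{of_int (k - 1) * L..of_int (k - 1) * L + L} = {t - L..t}" and B: "{of_int k * L..of_int k * L + L} = {t..t + L}"
      by (simp_all add: True left_diff_distrib)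
    have "(F \<longlongrightarrow> l) (at t within {t - L..t})" "(F \<longlongrightarrow> l) (at t within {t..t + L})"
      using lim[of "k - 1"] lim[of k] L unfolding A B by auto
    then have "(F \<longlongrightarrow> l) (at t within {t - L..t} \<union> {t..t + L})"
      unfolding at_within_union by (rule filterlim_sup)
    moreover have "{t - L..t} \<union> {t..t + L} = {t - L..t + L}" using L by auto
    moreover have "at t within {t - L..t + L} = at t"
      using L by (intro at_within_interior) simp
    ultimately show ?thesis by simp
  qed
qed

lemma periodic_extension_derivative:
  fixes f :: "real \<Rightarrow> 'a :: real_normed_vector"
  assumes L: "0 < L" and per: "f 0 = f L" "f' 0 = f' L"
    and d: "\<And>s. s \<in> {0..L} \<Longrightarrow> (f has_vector_derivative f' s) (at s within {0..L})"
  shows "(periodic_extension L f has_vector_derivative periodic_extension L f' t) (at t)"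
proof -
  let ?F = "periodic_extension L f" and ?D = "periodic_extension L f' t"
  have w: "(?F has_vector_derivative ?D) (at t within {of_int k * L..of_int k * L + L})"
    if t: "t \<in> {of_int k * L..of_int k * L + L}" for k :: int
  proof -
    let ?c = "of_int k * L"
    have img: "(\<lambda>x. x - ?c) ` {?c..?c + L} = {0..L}" by simp
    have "((f \<circ> (\<lambda>x. x - ?c)) has_vector_derivative (1 *\<^sub>R f' (t - ?c))) (at t within {?c..?c + L})"
    proof (rule vector_diff_chain_within)
      show "((\<lambda>x. x - ?c) has_vector_derivative 1) (at t within {?c..?c + L})"
        by (auto intro!: derivative_eq_intros)
      show "(f has_vector_derivative f' (t - ?c)) (at (t - ?c) within (\<lambda>x. x - ?c) ` {?c..?c + L})"
        unfolding img by (rule d) (use t in auto)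
    qed
    then have "((\<lambda>x. f (x - ?c)) has_vector_derivative f' (t - ?c)) (at t within {?c..?c + L})"
      by (simp add: o_def)
    then have "(?F has_vector_derivative f' (t - ?c)) (at t within {?c..?c + L})"
      by (rule has_vector_derivative_transform[rotated 2])
        (use t in \<open>auto simp: periodic_extension_eq[OF L per(1), of _ k]\<close>)
    then show ?thesis by (simp add: periodic_extension_eq[OF L per(2) t])
  qed
  show ?thesis
    unfolding has_vector_derivative_def has_derivative_within
  proof
    show "((\<lambda>y. (1 / norm (y - t)) *\<^sub>R (?F y - (?F t + (y - t) *\<^sub>R ?D))) \<longlongrightarrow> 0) (at t)"
      by (rule tendsto_at_from_period_intervals[OF L])
        (use w in \<open>auto simp: has_vector_derivative_def has_derivative_within\<close>)
  qed (rule bounded_linear_scaleR_left)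
qed

lemma periodic_extension_continuous:
  fixes f :: "real \<Rightarrow> 'a :: real_normed_vector"
  assumes L: "0 < L" and per: "f 0 = f L" and f: "continuous_on {0..L} f"
  shows "isCont (periodic_extension L f) t"
  unfolding continuous_at
proof (rule tendsto_at_from_period_intervals[OF L])
  fix k :: int assume t: "t \<in> {of_int k * L..of_int k * L + L}"
  let ?c = "of_int k * L"
  have "continuous_on {?c..?c + L} (\<lambda>x. f (x - ?c))"
    by (rule continuous_on_compose2[OF f]) (auto intro!: continuous_intros)
  then have "continuous_on {?c..?c + L} (periodic_extension L f)"
    by (rule continuous_on_eq) (auto simp: periodic_extension_eq[OF L per, of _ k])
  then show "(periodic_extension L f \<longlongrightarrow> periodic_extension L f t) (at t within {?c..?c + L})"
    using t by (simp add: continuous_on)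
qed

lemma closed_curve_periodic_extension:
  assumes L: "0 < L" and per: "\<gamma> 0 = \<gamma> L" "\<gamma>' 0 = \<gamma>' L" and inj: "inj_on \<gamma> {0..<L}"
    and d: "\<And>s. s \<in> {0..L} \<Longrightarrow> (\<gamma> has_vector_derivative \<gamma>' s) (at s within {0..L})"
    and c: "continuous_on {0..L} \<gamma>'" and unit: "\<And>s. s \<in> {0..L} \<Longrightarrow> norm (\<gamma>' s) = 1"
  shows "closed_curve L (periodic_extension L \<gamma>) (periodic_extension L \<gamma>')"
proof
  fix s t :: real
  show "norm (periodic_extension L \<gamma>' t) = 1"
    unfolding periodic_extension_def using period_remainder[OF L, of t] by (intro unit) auto
  assume eq: "periodic_extension L \<gamma> s = periodic_extension L \<gamma> t" and st: "\<bar>s - t\<bar> < L"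
  define j where "j = \<lfloor>s / L\<rfloor> - \<lfloor>t / L\<rfloor>"
  have "s - of_int \<lfloor>s / L\<rfloor> * L = t - of_int \<lfloor>t / L\<rfloor> * L"
    using inj_onD[OF inj eq[unfolded periodic_extension_def]] period_remainder[OF L] by blast
  then have sj: "s - t = of_int j * L" by (simp add: j_def algebra_simps)
  then have "\<bar>of_int j\<bar> * L < 1 * L" using st L by (simp add: abs_mult)
  then have "\<bar>real_of_int j\<bar> < 1" using L by (simp only: mult_less_cancel_right_pos)
  then have "j = 0" by linarith
  then show "s = t" using sj by simp
qed (use assms in \<open>auto intro!: periodic_extension_periodic periodic_extension_derivative periodic_extension_continuous\<close>)

lemma orthonormal_pair_spans_complex:
  fixes u v w :: complex
  assumes "norm u = 1" "norm v = 1" "u \<bullet> v = 0" "w \<bullet> u = 0" "w \<bullet> v = 0"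
  shows "w = 0"
proof -
  define D where "D = Re u * Im v - Im u * Re v"
  have uv: "(Re u)\<^sup>2 + (Im u)\<^sup>2 = 1" "(Re v)\<^sup>2 + (Im v)\<^sup>2 = 1" using assms(1,2) by (auto simp: norm_complex_def)
  have "D\<^sup>2 + (u \<bullet> v)\<^sup>2 = ((Re u)\<^sup>2 + (Im u)\<^sup>2) * ((Re v)\<^sup>2 + (Im v)\<^sup>2)"
    by (simp add: D_def inner_complex_def power2_eq_square algebra_simps)
  then have D: "D \<noteq> 0" using uv assms(3) by auto
  have "Re w * D = (w \<bullet> u) * Im v - (w \<bullet> v) * Im u" "Im w * D = (w \<bullet> v) * Re u - (w \<bullet> u) * Re v"
    by (simp_all add: D_def inner_complex_def algebra_simps)
  then show ?thesis using D assms(4,5) by (simp add: complex_eq_iff)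
qed

text \<open>
  Since \<open>f' 0 = 0\<close>, the tangent of the curve at \<open>\<gamma> t\<close> is a multiple of the first coordinate vector
  \<open>u\<close>. If the chord to \<open>\<gamma> s\<close> were orthogonal to the tangent, then \<open>\<gamma> s\<close> would be over the abscissa
  \<open>0\<close>, where the graph has only the point \<open>\<gamma> t\<close>.
\<close>

lemma (in closed_curve) TGL_no_critical:
  assumes fr: "frontier \<Omega> = range \<gamma>" and R: "0 < R" and tgl: "TGL_at \<Omega> R (\<gamma> t)"
    and st: "\<gamma> s \<noteq> \<gamma> t" "dist (\<gamma> s) (\<gamma> t) \<le> R"
  shows "(\<gamma> t - \<gamma> s) \<bullet> T t \<noteq> 0"
proof
  assume crit: "(\<gamma> t - \<gamma> s) \<bullet> T t = 0"
  obtain u v A f where uv: "norm u = 1" "norm v = 1" "u \<bullet> v = 0" and f: "f 0 = 0" "(f has_real_derivative 0) (at 0)"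
    and gr: "frontier \<Omega> \<inter> cball (\<gamma> t) R = (\<lambda>x. \<gamma> t + x *\<^sub>R u + f x *\<^sub>R v) ` A"
    using tgl unfolding TGL_at_def by blast
  have vu: "v \<bullet> u = 0" using uv(3) by (simp add: inner_commute)
  have uu: "u \<bullet> u = 1" "v \<bullet> v = 1" using uv by (simp_all add: dot_square_norm)
  have graph: "\<exists>x. \<gamma> y - \<gamma> t = x *\<^sub>R u + f x *\<^sub>R v" if "dist (\<gamma> t) (\<gamma> y) \<le> R" for y
  proof -
    have "\<gamma> y \<in> frontier \<Omega> \<inter> cball (\<gamma> t) R" using that fr by auto
    then obtain x where "\<gamma> y = \<gamma> t + x *\<^sub>R u + f x *\<^sub>R v" unfolding gr by blast
    then show ?thesis by (intro exI[of _ x]) simp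
  qed
  have coords: "(\<gamma> y - \<gamma> t) \<bullet> v = f ((\<gamma> y - \<gamma> t) \<bullet> u)" if "dist (\<gamma> t) (\<gamma> y) \<le> R" for y
    using graph[OF that] by (auto simp: inner_add_left uv(3) vu uu)
  have "((\<lambda>y. f ((\<gamma> y - \<gamma> t) \<bullet> u)) has_real_derivative 0 * (T t \<bullet> u)) (at t)"
    by (rule DERIV_chain2[OF _ chord_deriv]) (use f in simp)
  moreover have "\<forall>\<^sub>F y in nhds t. f ((\<gamma> y - \<gamma> t) \<bullet> u) = (\<gamma> y - \<gamma> t) \<bullet> v"
  proof -
    have "\<forall>\<^sub>F y in nhds t. dist y t < R" unfolding eventually_nhds_metric using R by blast
    then show ?thesis
    proof eventually_elim
      case (elim y)
      then have "dist (\<gamma> t) (\<gamma> y) \<le> R" using dist_le[of t y] by (simp add: dist_real_def)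
      then show ?case using coords by simp
    qed
  qed
  ultimately have "((\<lambda>y. (\<gamma> y - \<gamma> t) \<bullet> v) has_real_derivative 0) (at t)" by (simp cong: DERIV_cong_ev)
  then have Tv: "T t \<bullet> v = 0" using DERIV_unique[OF chord_deriv] by blast
  have Tu: "T t \<bullet> u \<noteq> 0" using orthonormal_pair_spans_complex[OF uv _ Tv] unit[of t] by auto
  obtain x where x: "\<gamma> s - \<gamma> t = x *\<^sub>R u + f x *\<^sub>R v" using graph[of s] st by (auto simp: dist_commute)
  have "x * (T t \<bullet> u) = (\<gamma> s - \<gamma> t) \<bullet> T t" using Tv
    by (simp add: x inner_add_left inner_commute[of v "T t"] inner_commute[of u "T t"])
  also have "\<dots> = 0" using crit by (simp add: inner_diff_left)
  finally have "x = 0" using Tu by simp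
  then show False using x f st(1) by simp
qed

lemma arclength_boundary_extension:
  assumes b: "arclength_boundary \<Omega> L \<gamma>" and tgl: "TGL \<Omega> R" and R: "0 < R"
  obtains T where "graphlike_region L (periodic_extension L \<gamma>) T R \<Omega>"
proof -
  let ?G = "periodic_extension L \<gamma>"
  obtain \<gamma>' where L: "0 < L" and comp: "compact \<Omega>" and fr: "frontier \<Omega> = \<gamma> ` {0..L}"
    and closes: "\<gamma> 0 = \<gamma> L" "\<gamma>' 0 = \<gamma>' L" and inj: "inj_on \<gamma> {0..<L}"
    and d: "\<And>s. s \<in> {0..L} \<Longrightarrow> (\<gamma> has_vector_derivative \<gamma>' s) (at s within {0..L})"
    and c: "continuous_on {0..L} \<gamma>'" and unit: "\<And>s. s \<in> {0..L} \<Longrightarrow> norm (\<gamma>' s) = 1"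
    and left: "\<And>s. s \<in> {0..L} \<Longrightarrow> \<forall>\<^sub>F \<epsilon> in at_right 0. \<gamma> s + \<epsilon> *\<^sub>R (\<i> * \<gamma>' s) \<in> interior \<Omega>"
    using b unfolding arclength_boundary_def by blast
  let ?T = "periodic_extension L \<gamma>'"
  interpret closed_curve L ?G ?T
    by (rule closed_curve_periodic_extension) (use L closes inj d c unit in auto)
  have rem: "t - of_int \<lfloor>t / L\<rfloor> * L \<in> {0..L}" for t using period_remainder[OF L, of t] by auto
  have fr': "frontier \<Omega> = range ?G"
  proof
    show "frontier \<Omega> \<subseteq> range ?G"
    proof
      fix p assume "p \<in> frontier \<Omega>"
      then obtain s where "s \<in> {0..L}" "p = \<gamma> s" unfolding fr by blast
      then have "p = ?G s" using periodic_extension_on_period[OF L closes(1)] by simp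
      then show "p \<in> range ?G" by blast
    qed
    show "range ?G \<subseteq> frontier \<Omega>" unfolding fr periodic_extension_def using rem by blast
  qed
  have "graphlike_region L ?G ?T R \<Omega>"
  proof
    show "(?G t - ?G s) \<bullet> ?T t \<noteq> 0" if "?G s \<noteq> ?G t" "dist (?G s) (?G t) \<le> R" for s t
      using tgl fr' that by (intro TGL_no_critical[OF fr' R]) (auto simp: TGL_def)
    show "\<forall>\<^sub>F \<epsilon> in at_right 0. ?G s + \<epsilon> *\<^sub>R (\<i> * ?T s) \<in> interior \<Omega>" for s
      unfolding periodic_extension_def by (rule left[OF rem])
  qed (use R comp fr' in auto)
  then show ?thesis by (rule that)
qed

section \<open>The reconstruction theorem\<close>

lemma graphlike_curve_rigid_motion:
  assumes "graphlike_curve L \<gamma> T R" and c: "norm c = 1"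
  shows "graphlike_curve L (\<lambda>t. a + c * \<gamma> t) (\<lambda>t. c * T t) R"
    and "exit_time (\<lambda>t. a + c * \<gamma> t) = exit_time \<gamma>"
proof -
  interpret graphlike_curve L \<gamma> T R by fact
  have diff: "(a + c * x) - (a + c * y) = c * (x - y)" for x y by (simp add: algebra_simps)
  have dist: "dist (a + c * x) (a + c * y) = dist x y" for x y
    by (simp only: dist_norm diff norm_mult c mult_1_left)
  have inner: "(c * x) \<bullet> (c * y) = x \<bullet> y" for x y
  proof -
    have "(Re c)\<^sup>2 + (Im c)\<^sup>2 = 1" using c by (simp add: norm_complex_def)
    moreover have "(c * x) \<bullet> (c * y) = ((Re c)\<^sup>2 + (Im c)\<^sup>2) * (x \<bullet> y)"
      by (simp add: inner_complex_def power2_eq_square algebra_simps)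
    ultimately show ?thesis by simp
  qed
  have c0: "c \<noteq> 0" using c by auto
  show "graphlike_curve L (\<lambda>t. a + c * \<gamma> t) (\<lambda>t. c * T t) R"
  proof
    show "((\<lambda>t. a + c * \<gamma> t) has_vector_derivative c * T t) (at t)" for t
      using has_vector_derivative_add[OF has_vector_derivative_const has_vector_derivative_mult_right[OF deriv]]
      by simp
    show "isCont (\<lambda>t. c * T t) t" for t by (intro continuous_intros contT)
    show "s = t" if "a + c * \<gamma> s = a + c * \<gamma> t" "\<bar>s - t\<bar> < L" for s t
      using inj[of s t] that c0 by simp
    show "((a + c * \<gamma> t) - (a + c * \<gamma> s)) \<bullet> (c * T t) \<noteq> 0"
      if "a + c * \<gamma> s \<noteq> a + c * \<gamma> t" "dist (a + c * \<gamma> s) (a + c * \<gamma> t) \<le> R" for s t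
      unfolding diff inner using no_critical[of s t] that unfolding dist by auto
  qed (auto simp: L R per perT norm_mult unit c)
  show "exit_time (\<lambda>t. a + c * \<gamma> t) = exit_time \<gamma>" by (intro ext) (simp only: exit_time_def dist)
qed

theorem lemma26:
  fixes \<Omega>1 \<Omega>2 :: "complex set" and \<gamma>1 \<gamma>2 :: "real \<Rightarrow> complex" and L rhat shat :: real
  assumes "arclength_boundary \<Omega>1 L \<gamma>1" and "arclength_boundary \<Omega>2 L \<gamma>2"
    and "0 < rhat" and "TGL \<Omega>1 rhat" and "TGL \<Omega>2 rhat"
    and "shat \<in> {0..L}"
    and "\<And>s r. (s, r) \<in> ({0..L} \<times> {rhat}) \<union> ({shat} \<times> {0<..rhat}) \<Longrightarrow>
           area_inv \<Omega>1 \<gamma>1 s r = area_inv \<Omega>2 \<gamma>2 s r \<and>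
           area_inv_s \<Omega>1 L \<gamma>1 s r = area_inv_s \<Omega>2 L \<gamma>2 s r \<and>
           area_inv_r \<Omega>1 \<gamma>1 s r = area_inv_r \<Omega>2 \<gamma>2 s r"
  shows "\<exists>a \<theta> \<phi>. reparametrization L \<phi> \<and>
           (\<forall>s\<in>{0..L}. \<gamma>2 s = a + cis \<theta> * \<gamma>1 (\<phi> s))"
proof -
  let ?G1 = "periodic_extension L \<gamma>1" and ?G2 = "periodic_extension L \<gamma>2"
  have L: "0 < L" "\<gamma>1 0 = \<gamma>1 L" "\<gamma>2 0 = \<gamma>2 L" using assms(1,2) by (auto simp: arclength_boundary_def)
  obtain T1 where T1: "graphlike_region L ?G1 T1 rhat \<Omega>1"
    using arclength_boundary_extension[OF assms(1,4,3)] .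
  obtain T2 where T2: "graphlike_region L ?G2 T2 rhat \<Omega>2"
    using arclength_boundary_extension[OF assms(2,5,3)] .
  interpret c1: graphlike_region L ?G1 T1 rhat \<Omega>1 by (rule T1)
  interpret c2: graphlike_region L ?G2 T2 rhat \<Omega>2 by (rule T2)
  define g1 where "g1 s r = measure lebesgue (\<Omega>1 \<inter> cball (?G1 s) r)" for s r
  define g2 where "g2 s r = measure lebesgue (\<Omega>2 \<inter> cball (?G2 s) r)" for s r
  define rm where "rm s = s - of_int \<lfloor>s / L\<rfloor> * L" for s
  have rm: "rm s \<in> {0..L}" "?G1 s = \<gamma>1 (rm s)" "?G2 s = \<gamma>2 (rm s)" for s
    using period_remainder[OF L(1), of s] by (auto simp: periodic_extension_def rm_def)
  have on: "?G1 s = \<gamma>1 s" "?G2 s = \<gamma>2 s" if "s \<in> {0..L}" for s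
    using that L by (auto intro: periodic_extension_on_period)
  have radius: "\<exists>D. ((\<lambda>r. g1 s r) has_real_derivative D) (at r) \<and> ((\<lambda>r. g2 s r) has_real_derivative D) (at r)"
    if s0: "?G1 s = \<gamma>1 s0" "?G2 s = \<gamma>2 s0" and r: "0 < r" "r \<le> rhat"
      and eq: "area_inv_r \<Omega>1 \<gamma>1 s0 r = area_inv_r \<Omega>2 \<gamma>2 s0 r" for s s0 r
  proof -
    obtain D1 where D1: "((\<lambda>r. g1 s r) has_real_derivative D1) (at r)"
      using c1.area_invariant_derivative_radius[OF r, of s] unfolding g1_def by blast
    obtain D2 where D2: "((\<lambda>r. g2 s r) has_real_derivative D2) (at r)"
      using c2.area_invariant_derivative_radius[OF r, of s] unfolding g2_def by blast
    have "D1 = area_inv_r \<Omega>1 \<gamma>1 s0 r" "D2 = area_inv_r \<Omega>2 \<gamma>2 s0 r"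
      using DERIV_imp_deriv[OF D1] DERIV_imp_deriv[OF D2]
      by (simp_all add: area_inv_r_def area_inv_def g1_def g2_def s0)
    then show ?thesis using D1 D2 eq by auto
  qed
  have chord: "(?G1 (exit_time ?G1 s rhat) - ?G1 s) / T1 s = (?G2 (exit_time ?G2 s rhat) - ?G2 s) / T2 s" for s
  proof -
    have data: "area_inv \<Omega>1 \<gamma>1 (rm t) rhat = area_inv \<Omega>2 \<gamma>2 (rm t) rhat"
      "area_inv_r \<Omega>1 \<gamma>1 (rm t) rhat = area_inv_r \<Omega>2 \<gamma>2 (rm t) rhat" for t
      using assms(7)[of "rm t" rhat] rm(1)[of t] by auto
    have "g1 t rhat = g2 t rhat" for t
      using data(1)[of t] by (simp add: g1_def g2_def rm area_inv_def)
    \<comment> \<open>The areas agree for all parameters at this radius, so their derivatives along the curve do, too.\<close>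
    then have same: "(\<lambda>t. g1 t rhat) = (\<lambda>t. g2 t rhat)" by blast
    obtain Ds where Ds: "((\<lambda>t. g1 t rhat) has_real_derivative Ds) (at s)"
      using c1.area_invariant_derivative_position[OF c1.R order_refl, of s] unfolding g1_def by blast
    obtain Dr where Dr: "((\<lambda>r. g1 s r) has_real_derivative Dr) (at rhat)" "((\<lambda>r. g2 s r) has_real_derivative Dr) (at rhat)"
      using radius[OF rm(2,3) c1.R order_refl data(2), of s] by blast
    show ?thesis
      using area_data_determine_exit_chord[OF T1 T2 c1.R order_refl, of Ds s Dr] Ds Ds[unfolded same] Dr
      by (simp only: g1_def g2_def)
  qed
  have chord0: "(?G1 (exit_time ?G1 shat r) - ?G1 shat) / T1 shat = (?G2 (exit_time ?G2 shat r) - ?G2 shat) / T2 shat"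
    if r: "0 < r" "r \<le> rhat" for r
  proof -
    have data: "area_inv_s \<Omega>1 L \<gamma>1 shat r = area_inv_s \<Omega>2 L \<gamma>2 shat r"
      "area_inv_r \<Omega>1 \<gamma>1 shat r = area_inv_r \<Omega>2 \<gamma>2 shat r"
      using assms(7)[of shat r] r by auto
    have vd: "vector_derivative (\<lambda>t. area_inv \<Omega> \<gamma> t r) (at shat within {0..L}) = D"
      if D: "((\<lambda>t. measure lebesgue (\<Omega> \<inter> cball (periodic_extension L \<gamma> t) r)) has_real_derivative D) (at shat)"
        and p: "\<gamma> 0 = \<gamma> L" for \<Omega> \<gamma> and D :: real
    proof -
      have "((\<lambda>t. measure lebesgue (\<Omega> \<inter> cball (periodic_extension L \<gamma> t) r)) has_vector_derivative D) (at shat within {0..L})"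
        using D by (simp add: has_real_derivative_iff_has_vector_derivative has_vector_derivative_at_within)
      then have "((\<lambda>t. area_inv \<Omega> \<gamma> t r) has_vector_derivative D) (at shat within {0..L})"
        by (rule has_vector_derivative_transform[rotated 2])
          (use assms(6) in \<open>auto simp: area_inv_def periodic_extension_on_period[of L \<gamma>, OF L(1) p]\<close>)
      then show ?thesis
        using assms(6) L(1) by (intro vector_derivative_within_closed_interval) auto
    qed
    obtain D1 where D1: "((\<lambda>t. g1 t r) has_real_derivative D1) (at shat)"
      using c1.area_invariant_derivative_position[OF r, of shat] unfolding g1_def by blast
    obtain D2 where D2: "((\<lambda>t. g2 t r) has_real_derivative D2) (at shat)"
      using c2.area_invariant_derivative_position[OF r, of shat] unfolding g2_def by blast
    have "D1 = D2"
      using vd[OF D1[unfolded g1_def] L(2)] vd[OF D2[unfolded g2_def] L(3)] data(1) by (simp add: area_inv_s_def)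
    moreover obtain Dr where Dr: "((\<lambda>r. g1 shat r) has_real_derivative Dr) (at r)" "((\<lambda>r. g2 shat r) has_real_derivative Dr) (at r)"
      using radius[OF on[OF assms(6)] r data(2)] by blast
    ultimately show ?thesis
      using area_data_determine_exit_chord[OF T1 T2 r, of D1 shat Dr] D1 D2 Dr by (simp only: g1_def g2_def)
  qed
  \<comment> \<open>The rigid motion that carries the frame of the first curve at \<open>shat\<close> to that of the second.\<close>
  define c where "c = T2 shat / T1 shat"
  define a where "a = ?G2 shat - c * ?G1 shat"
  have T0: "T1 s \<noteq> 0" for s using c1.unit[of s] by auto
  have c: "norm c = 1" by (simp add: c_def norm_divide c1.unit c2.unit)
  then have c0: "c \<noteq> 0" by auto
  note motion = graphlike_curve_rigid_motion[OF c1.graphlike_curve_axioms c, of a]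
  have quot: "((a + c * x) - (a + c * y)) / (c * z) = (x - y) / z" for x y z
    using c0 by (simp add: right_diff_distrib[symmetric])
  have agree: "a + c * ?G1 t = ?G2 t" if "shat \<le> t" for t
  proof (rule exit_chords_determine_curve[OF motion(1) c2.graphlike_curve_axioms _ _ _ _ that])
    show "a + c * ?G1 shat = ?G2 shat" by (simp add: a_def)
    show "c * T1 shat = T2 shat" using T0 by (simp add: c_def)
  qed (unfold motion(2) quot, use chord chord0 in auto)
  obtain \<theta> where \<theta>: "c = cis \<theta>" using cis_Arg[OF c0] c by (metis sgn_div_norm scaleR_one inverse_1)
  have "\<gamma>2 s = a + cis \<theta> * \<gamma>1 (id s)" if s: "s \<in> {0..L}" for s
  proof -
    \<comment> \<open>The curves agree after \<open>shat\<close>, so \<open>s\<close> is moved forward by one period.\<close>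
    have "?G2 (s + L) = a + c * ?G1 (s + L)" using agree[of "s + L"] s assms(6) by simp
    then show ?thesis using s by (simp add: c1.per c2.per on \<theta>)
  qed
  moreover have "reparametrization L id" by (simp add: reparametrization_def strict_mono_on_def)
  ultimately show ?thesis by blast
qed

end
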